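(* Let $(\Omega,\sigma)$ be an irreducible sofic shift over a finite alphabet. Let $\varphi=(\varphi_1,\ldots,\varphi_d)\in C(\Omega,\mathbb{Q}^d)$ be a $\mathbb{Q}^d$-valued locally constant function and let $h\in \operatorname{int}(\mathrm{Rot}(\varphi))\cap\mathbb{Q}^d$. Then there is a residual (dense $G_\delta$) subset $R\subset C(\Omega,\mathbb R)$ such that for every $f\in R$, every $\mu\in\mathcal M^\varphi_h(f)$ has zero measure-theoretic entropy $h_\mu(\sigma)=0$.
   Context: Let $\mathcal A$ be a finite set, $\mathbb N_0=\{0,1,2,\dots\}$, and $\mathcal A^{\mathbb N_0}$ carry the product of discrete topologies; $\sigma$ is the left shift. A subshift is a closed $\sigma$-invariant $\Omega\subset\mathcal A^{\mathbb N_0}$, with language $\mathcal L(\Omega)$ the set of finite words $u$ whose cylinder $[u]=\{\underline x\in\Omega: x_0\cdots x_{|u|-1}=u\}$ is nonempty. $\Omega$ is irreducible if for all symbols $i,j$ there is $u\in\mathcal L(\Omega)$ with $iuj\in\mathcal L(\Omega)$. The follower set of $u$ is $F_\Omega(u)=\{v\in\mathcal L(\Omega):uv\in\mathcal L(\Omega)\}$; $\Omega$ is sofic if there are only finitely many distinct follower sets. $\varphi$ is locally constant if each $\varphi_i(x)$ depends only on $x_0,\dots,x_{k_i}$ for some $k_i\ge0$. $C(\Omega,\mathbb R)$ has the sup norm. $\mathcal M_\sigma(\Omega)$ is the set of $\sigma$-invariant Borel probability measures (weak* topology). $\mathrm{rv}_\varphi(\mu)=(\int\varphi_1d\mu,\dots,\int\varphi_dd\mu)$,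 $\mathrm{Rot}(\varphi)=\{\mathrm{rv}_\varphi(\mu):\mu\in\mathcal M_\sigma(\Omega)\}$. For $h\in\mathrm{Rot}(\varphi)$ and $f\in C(\Omega,\mathbb R)$: $\beta^\varphi_h(f)=\sup_{\mu\in\mathrm{rv}_\varphi^{-1}(h)}\int f\,d\mu$ and $\mathcal M^\varphi_h(f)=\{\mu\in\mathcal M_\sigma(\Omega):\mathrm{rv}_\varphi(\mu)=h,\ \int f\,d\mu=\beta^\varphi_h(f)\}$ (relative maximizing measures of $f$ with constraint $h$). *)

theory Defs
  imports "HOL-Probability.Probability"
begin

definition shift_top :: "(nat \<Rightarrow> 'a) topology" where
  "shift_top = product_topology (\<lambda>_::nat. discrete_topology (UNIV::'a set)) UNIV"

definition shift :: "(nat \<Rightarrow> 'a) \<Rightarrow> (nat \<Rightarrow> 'a)" where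
  "shift x = (\<lambda>n. x (Suc n))"

definition subshift :: "(nat \<Rightarrow> 'a::finite) set \<Rightarrow> bool" where
  "subshift \<Omega> \<longleftrightarrow> closedin shift_top \<Omega> \<and> shift ` \<Omega> \<subseteq> \<Omega>"

definition cylinder :: "(nat \<Rightarrow> 'a) set \<Rightarrow> 'a list \<Rightarrow> (nat \<Rightarrow> 'a) set" where
  "cylinder \<Omega> u = {x \<in> \<Omega>. \<forall>i < length u. x i = u ! i}"

definition language :: "(nat \<Rightarrow> 'a) set \<Rightarrow> 'a list set" where
  "language \<Omega> = {u. cylinder \<Omega> u \<noteq> {}}"

definition irreducible_shift :: "(nat \<Rightarrow> 'a) set \<Rightarrow> bool" where
  "irreducible_shift \<Omega> \<longleftrightarrow>
     (\<forall>i j::'a. \<exists>u \<in> language \<Omega>. [i] @ u @ [j] \<in> language \<Omega>)"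

definition follower_set :: "(nat \<Rightarrow> 'a) set \<Rightarrow> 'a list \<Rightarrow> 'a list set" where
  "follower_set \<Omega> u = {v \<in> language \<Omega>. u @ v \<in> language \<Omega>}"

definition sofic :: "(nat \<Rightarrow> 'a) set \<Rightarrow> bool" where
  "sofic \<Omega> \<longleftrightarrow> finite (range (follower_set \<Omega>))"

definition borel_shift :: "(nat \<Rightarrow> 'a) set \<Rightarrow> (nat \<Rightarrow> 'a) measure" where
  "borel_shift \<Omega> = sigma \<Omega> {U. openin (subtopology shift_top \<Omega>) U}"

definition inv_measures :: "(nat \<Rightarrow> 'a) set \<Rightarrow> (nat \<Rightarrow> 'a) measure set" where
  "inv_measures \<Omega> = {M. sets M = sets (borel_shift \<Omega>) \<and> prob_space M \<and>
      (\<forall>A \<in> sets M. emeasure M {x \<in> \<Omega>. shift x \<in> A} = emeasure M A)}"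

definition rot_vec :: "((nat \<Rightarrow> 'a) \<Rightarrow> real ^ 'd) \<Rightarrow> (nat \<Rightarrow> 'a) measure \<Rightarrow> real ^ 'd" where
  "rot_vec \<phi> M = (\<chi> i. integral\<^sup>L M (\<lambda>x. \<phi> x $ i))"

definition rot_set :: "(nat \<Rightarrow> 'a) set \<Rightarrow> ((nat \<Rightarrow> 'a) \<Rightarrow> real ^ 'd) \<Rightarrow> (real ^ 'd) set" where
  "rot_set \<Omega> \<phi> = rot_vec \<phi> ` inv_measures \<Omega>"

definition rel_max_value ::
  "(nat \<Rightarrow> 'a) set \<Rightarrow> ((nat \<Rightarrow> 'a) \<Rightarrow> real ^ 'd) \<Rightarrow> real ^ 'd \<Rightarrow> ((nat \<Rightarrow> 'a) \<Rightarrow> real) \<Rightarrow> real" where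
  "rel_max_value \<Omega> \<phi> h f =
     Sup {integral\<^sup>L M f | M. M \<in> inv_measures \<Omega> \<and> rot_vec \<phi> M = h}"

definition rel_max_measures ::
  "(nat \<Rightarrow> 'a) set \<Rightarrow> ((nat \<Rightarrow> 'a) \<Rightarrow> real ^ 'd) \<Rightarrow> real ^ 'd \<Rightarrow> ((nat \<Rightarrow> 'a) \<Rightarrow> real)
     \<Rightarrow> (nat \<Rightarrow> 'a) measure set" where
  "rel_max_measures \<Omega> \<phi> h f =
     {M \<in> inv_measures \<Omega>. rot_vec \<phi> M = h \<and> integral\<^sup>L M f = rel_max_value \<Omega> \<phi> h f}"

definition locally_constant :: "(nat \<Rightarrow> 'a) set \<Rightarrow> ((nat \<Rightarrow> 'a) \<Rightarrow> real ^ 'd) \<Rightarrow> bool" where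
  "locally_constant \<Omega> \<phi> \<longleftrightarrow>
     (\<forall>i. \<exists>k. \<forall>x \<in> \<Omega>. \<forall>y \<in> \<Omega>. (\<forall>j \<le> k. x j = y j) \<longrightarrow> \<phi> x $ i = \<phi> y $ i)"

text \<open>Kolmogorov--Sinai entropy. A finite measurable partition of \<Omega> is encoded by a
  measurable labelling \<xi> : \<Omega> \<rightarrow> nat with finitely many values; the n-th refinement
  \<xi> \<or> \<sigma>^{-1}\<xi> \<or> ... \<or> \<sigma>^{-(n-1)}\<xi> is given by the itinerary labels.\<close>

definition eta :: "real \<Rightarrow> real" where
  "eta t = (if t = 0 then 0 else - t * ln t)"

definition itinerary :: "((nat \<Rightarrow> 'a) \<Rightarrow> nat) \<Rightarrow> nat \<Rightarrow> (nat \<Rightarrow> 'a) \<Rightarrow> nat list" where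
  "itinerary \<xi> n x = map (\<lambda>i. \<xi> ((shift ^^ i) x)) [0..<n]"

definition partition_entropy ::
  "(nat \<Rightarrow> 'a) set \<Rightarrow> (nat \<Rightarrow> 'a) measure \<Rightarrow> ((nat \<Rightarrow> 'a) \<Rightarrow> nat) \<Rightarrow> nat \<Rightarrow> real" where
  "partition_entropy \<Omega> M \<xi> n =
     (\<Sum>v \<in> itinerary \<xi> n ` \<Omega>. eta (measure M {x \<in> \<Omega>. itinerary \<xi> n x = v}))"

definition finite_partitions :: "(nat \<Rightarrow> 'a) set \<Rightarrow> ((nat \<Rightarrow> 'a) \<Rightarrow> nat) set" where
  "finite_partitions \<Omega> =
     {\<xi>. \<xi> \<in> measurable (borel_shift \<Omega>) (count_space UNIV) \<and> finite (\<xi> ` \<Omega>)}"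

definition ks_entropy :: "(nat \<Rightarrow> 'a) set \<Rightarrow> (nat \<Rightarrow> 'a) measure \<Rightarrow> ereal" where
  "ks_entropy \<Omega> M =
     (SUP \<xi> \<in> finite_partitions \<Omega>.
        ereal (lim (\<lambda>n. partition_entropy \<Omega> M \<xi> n / real n)))"

definition cont_fun :: "(nat \<Rightarrow> 'a) set \<Rightarrow> ((nat \<Rightarrow> 'a) \<Rightarrow> real) set" where
  "cont_fun \<Omega> = {f. continuous_map (subtopology shift_top \<Omega>) euclideanreal f \<and>
                     (\<forall>x. x \<notin> \<Omega> \<longrightarrow> f x = 0)}"

definition sup_dist :: "(nat \<Rightarrow> 'a) set \<Rightarrow> ((nat \<Rightarrow> 'a) \<Rightarrow> real) \<Rightarrow> ((nat \<Rightarrow> 'a) \<Rightarrow> real) \<Rightarrow> real" where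
  "sup_dist \<Omega> f g = (SUP x \<in> \<Omega>. \<bar>f x - g x\<bar>)"

definition open_in_C :: "(nat \<Rightarrow> 'a) set \<Rightarrow> ((nat \<Rightarrow> 'a) \<Rightarrow> real) set \<Rightarrow> bool" where
  "open_in_C \<Omega> U \<longleftrightarrow> U \<subseteq> cont_fun \<Omega> \<and>
     (\<forall>f \<in> U. \<exists>e > 0. \<forall>g \<in> cont_fun \<Omega>. sup_dist \<Omega> f g < e \<longrightarrow> g \<in> U)"

definition dense_in_C :: "(nat \<Rightarrow> 'a) set \<Rightarrow> ((nat \<Rightarrow> 'a) \<Rightarrow> real) set \<Rightarrow> bool" where
  "dense_in_C \<Omega> R \<longleftrightarrow> R \<subseteq> cont_fun \<Omega> \<and>
     (\<forall>f \<in> cont_fun \<Omega>. \<forall>e > 0. \<exists>g \<in> R. sup_dist \<Omega> f g < e)"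

definition dense_Gdelta_in_C :: "(nat \<Rightarrow> 'a) set \<Rightarrow> ((nat \<Rightarrow> 'a) \<Rightarrow> real) set \<Rightarrow> bool" where
  "dense_Gdelta_in_C \<Omega> R \<longleftrightarrow> dense_in_C \<Omega> R \<and>
     (\<exists>U :: nat \<Rightarrow> ((nat \<Rightarrow> 'a) \<Rightarrow> real) set. (\<forall>n. open_in_C \<Omega> (U n)) \<and> R = (\<Inter>n. U n))"

end

theory Submission
  imports Defs
begin

text \<open>
  Let \<open>f\<close> be a function of finitely many coordinates. Its Birkhoff sums, and those of \<open>\<phi>\<close>, are
  weights of walks in the finite follower-set graph of the sofic shift, and every walk decomposes
  into simple cycles up to a bounded remainder. Hence the vectors \<open>(\<integral>f d\<mu>, rv(\<mu>))\<close> fill out the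
  convex hull of finitely many periodic orbit averages, and under the constraint \<open>rv(\<mu>) = h\<close> the
  function \<open>f\<close> has a maximizing measure \<open>\<nu>\<close> carried by a finite set \<open>Z\<close>.

  Now subtract from \<open>f\<close> a small multiple of the indicator of the points whose first \<open>L\<close> letters are
  not those of a point of \<open>Z\<close>. The measure \<open>\<nu>\<close> does not feel this penalty, so every relative
  maximizing measure of every sufficiently close function gives the penalized set arbitrarily small
  mass, and its \<open>L\<close>-block entropy is at most \<open>ln (card Z) + 3\<close>. As \<open>L\<close> is chosen after \<open>Z\<close>, the
  functions all of whose relative maximizing measures have block entropy rate below \<open>1 / (m + 1)\<close>
  contain a dense open set. Baire's theorem and the fact that blocks generate finish the proof.
\<close>

section \<open>Subshifts and functions of finitely many coordinates\<close>

definition block :: "nat \<Rightarrow> (nat \<Rightarrow> 'a) \<Rightarrow> 'a list" where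
  "block k x = map x [0..<k]"

lemma length_block [simp]: "length (block k x) = k"
  by (simp add: block_def)

lemma nth_block [simp]: "i < k \<Longrightarrow> block k x ! i = x i"
  by (simp add: block_def)

lemma block_eq_iff: "block k x = block k y \<longleftrightarrow> (\<forall>i<k. x i = y i)"
  by (auto simp: list_eq_iff_nth_eq)

lemma block_eq_mono: "block k x = block k y \<Longrightarrow> j \<le> k \<Longrightarrow> block j x = block j y"
  by (auto simp: block_eq_iff)

lemma finite_range_block: "finite (range (block k :: (nat \<Rightarrow> 'a::finite) \<Rightarrow> 'a list))"
  by (rule finite_subset[OF _ finite_lists_length_eq[of UNIV k]]) auto

lemma finite_image_block: "finite ((block k :: (nat \<Rightarrow> 'a::finite) \<Rightarrow> 'a list) ` A)"
  by (rule finite_subset[OF _ finite_range_block]) auto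

lemma shift_funpow: "(shift ^^ n) x i = x (n + i)"
  by (induction n arbitrary: i) (simp_all add: shift_def)

text \<open>A basic open box of the product restricts only finitely many coordinates, hence only an
  initial block. All later topological arguments go through this description.\<close>

lemma openin_shift_top_iff:
  "openin shift_top T \<longleftrightarrow> (\<forall>x\<in>T. \<exists>k. \<forall>y. block k y = block k x \<longrightarrow> y \<in> T)"
proof
  assume T: "openin shift_top T"
  show "\<forall>x\<in>T. \<exists>k. \<forall>y. block k y = block k x \<longrightarrow> y \<in> T"
  proof
    fix x assume "x \<in> T"
    then obtain U where U: "finite {i. U i \<noteq> UNIV}" "x \<in> Pi\<^sub>E UNIV U" "Pi\<^sub>E UNIV U \<subseteq> T"
      using T unfolding shift_top_def openin_product_topology_alt by auto
    obtain k where k: "\<And>i. U i \<noteq> UNIV \<Longrightarrow> i < k"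
      using U(1) unfolding finite_nat_set_iff_bounded by auto
    have "y \<in> T" if "block k y = block k x" for y
    proof -
      have "y i \<in> U i" for i
        using that k[of i] U(2) by (cases "U i = UNIV") (auto simp: block_eq_iff PiE_iff)
      then show ?thesis using U(3) by auto
    qed
    then show "\<exists>k. \<forall>y. block k y = block k x \<longrightarrow> y \<in> T" by blast
  qed
next
  assume R: "\<forall>x\<in>T. \<exists>k. \<forall>y. block k y = block k x \<longrightarrow> y \<in> T"
  show "openin shift_top T"
    unfolding shift_top_def openin_product_topology_alt
  proof
    fix x assume "x \<in> T"
    with R obtain k where k: "\<And>y. block k y = block k x \<Longrightarrow> y \<in> T" by blast
    let ?U = "\<lambda>i. if i < k then {x i} else UNIV"
    have "finite {i. ?U i \<noteq> UNIV}"
      by (rule finite_subset[of _ "{..<k}"]) auto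
    moreover have "Pi\<^sub>E UNIV ?U \<subseteq> T"
      by (auto intro!: k simp: block_eq_iff PiE_iff) (metis singletonD)
    ultimately show "\<exists>U. finite {i \<in> UNIV. U i \<noteq> topspace (discrete_topology UNIV)} \<and>
         (\<forall>i\<in>UNIV. openin (discrete_topology UNIV) (U i)) \<and> x \<in> Pi\<^sub>E UNIV U \<and> Pi\<^sub>E UNIV U \<subseteq> T"
      by (intro exI[of _ ?U]) auto
  qed
qed

lemma topspace_shift_top [simp]: "topspace shift_top = UNIV"
  by (simp add: shift_top_def)

lemma openin_subshift_iff:
  "openin (subtopology shift_top \<Omega>) U \<longleftrightarrow>
     U \<subseteq> \<Omega> \<and> (\<forall>x\<in>U. \<exists>k. \<forall>y\<in>\<Omega>. block k y = block k x \<longrightarrow> y \<in> U)"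
proof
  assume "openin (subtopology shift_top \<Omega>) U"
  then show "U \<subseteq> \<Omega> \<and> (\<forall>x\<in>U. \<exists>k. \<forall>y\<in>\<Omega>. block k y = block k x \<longrightarrow> y \<in> U)"
    unfolding openin_subtopology openin_shift_top_iff by (metis IntD1 IntD2 IntI inf_le2)
next
  assume U: "U \<subseteq> \<Omega> \<and> (\<forall>x\<in>U. \<exists>k. \<forall>y\<in>\<Omega>. block k y = block k x \<longrightarrow> y \<in> U)"
  then obtain k where k: "\<And>x y. x \<in> U \<Longrightarrow> y \<in> \<Omega> \<Longrightarrow> block (k x) y = block (k x) x \<Longrightarrow> y \<in> U"
    by metis
  \<comment> \<open>A union of full cylinders in the ambient sequence space, whose trace on
    \<open>\<Omega>\<close> is \<open>U\<close>.\<close>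
  let ?T = "{y. \<exists>x\<in>U. block (k x) y = block (k x) x}"
  have "openin shift_top ?T" unfolding openin_shift_top_iff
  proof
    fix x assume "x \<in> ?T"
    then obtain c where "c \<in> U" "block (k c) x = block (k c) c" by blast
    then show "\<exists>j. \<forall>y. block j y = block j x \<longrightarrow> y \<in> ?T"
      by (intro exI[of _ "k c"]) auto
  qed
  moreover have "U = ?T \<inter> \<Omega>" using U k by auto
  ultimately show "openin (subtopology shift_top \<Omega>) U"
    unfolding openin_subtopology by blast
qed

text \<open>As \<open>\<Omega>\<close> is closed, a point outside it has a whole cylinder outside
  it, whereas a word of the language is an initial block of some point of
  \<open>\<Omega>\<close>.\<close>

lemma mem_subshiftI:
  assumes "subshift \<Omega>" and "\<And>n. block n y \<in> language \<Omega>"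
  shows "y \<in> \<Omega>"
proof (rule ccontr)
  assume "y \<notin> \<Omega>"
  moreover have "openin shift_top (- \<Omega>)"
    using assms(1) by (simp add: subshift_def closedin_def Compl_eq_Diff_UNIV)
  ultimately obtain k where k: "\<And>z. block k z = block k y \<Longrightarrow> z \<notin> \<Omega>"
    unfolding openin_shift_top_iff by fastforce
  obtain z where "z \<in> cylinder \<Omega> (block k y)"
    using assms(2)[of k] unfolding language_def by blast
  then show False
    using k[of z] by (auto simp: cylinder_def block_eq_iff)
qed

lemma shift_mem: "subshift \<Omega> \<Longrightarrow> x \<in> \<Omega> \<Longrightarrow> shift x \<in> \<Omega>"
  by (auto simp: subshift_def)

lemma shift_funpow_mem: "subshift \<Omega> \<Longrightarrow> x \<in> \<Omega> \<Longrightarrow> (shift ^^ n) x \<in> \<Omega>"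
  by (induction n) (auto intro: shift_mem)

lemma block_mem_language: "x \<in> \<Omega> \<Longrightarrow> block n x \<in> language \<Omega>"
  by (auto simp: language_def cylinder_def)

lemma compactin_subshift:
  assumes "subshift (\<Omega> :: (nat \<Rightarrow> 'a::finite) set)"
  shows "compactin shift_top \<Omega>"
proof -
  have "compact_space (shift_top :: (nat \<Rightarrow> 'a) topology)"
    unfolding shift_top_def
    by (simp add: compact_space_product_topology compact_space_discrete_topology)
  then show ?thesis
    using assms closedin_compact_space by (auto simp: subshift_def)
qed

text \<open>The Heine-Cantor argument: finitely many cylinders of small oscillation cover
  \<open>\<Omega>\<close>, and the longest of their defining blocks serves for all. Each of the two
  points is compared with the centre of a cylinder at cost \<open>e / 2\<close>.\<close>

lemma continuous_imp_block_uniform: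
  fixes \<Omega> :: "(nat \<Rightarrow> 'a::finite) set" and f :: "_ \<Rightarrow> real"
  assumes "subshift \<Omega>" and f: "continuous_map (subtopology shift_top \<Omega>) euclideanreal f"
    and "e > 0"
  shows "\<exists>k. \<forall>x\<in>\<Omega>. \<forall>y\<in>\<Omega>. block k x = block k y \<longrightarrow> \<bar>f x - f y\<bar> < e"
proof -
  have "\<exists>k. \<forall>y\<in>\<Omega>. block k y = block k x \<longrightarrow> \<bar>f y - f x\<bar> < e / 2" if "x \<in> \<Omega>" for x
  proof -
    define S where "S = {y \<in> topspace (subtopology shift_top \<Omega>). f y \<in> ball (f x) (e / 2)}"
    have "openin (subtopology shift_top \<Omega>) S"
      unfolding S_def by (rule openin_continuous_map_preimage[OF f]) simp
    moreover have "x \<in> S" using that \<open>e > 0\<close> by (simp add: S_def)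
    ultimately obtain k where "\<forall>y\<in>\<Omega>. block k y = block k x \<longrightarrow> y \<in> S"
      unfolding openin_subshift_iff by meson
    then show ?thesis
      unfolding S_def by (intro exI[of _ k]) (simp add: dist_real_def abs_minus_commute)
  qed
  then obtain k where k: "\<And>x y. x \<in> \<Omega> \<Longrightarrow> y \<in> \<Omega> \<Longrightarrow> block (k x) y = block (k x) x \<Longrightarrow> \<bar>f y - f x\<bar> < e / 2"
    by metis
  define N where "N x = {y. block (k x) y = block (k x) x}" for x
  have "openin shift_top (N x)" for x
    unfolding openin_shift_top_iff N_def by (intro ballI exI[of _ "k x"]) simp
  moreover have "\<Omega> \<subseteq> \<Union> (N ` \<Omega>)" by (auto simp: N_def)
  ultimately obtain \<F> where F: "finite \<F>" "\<F> \<subseteq> N ` \<Omega>" "\<Omega> \<subseteq> \<Union>\<F>"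
    using compactin_subshift[OF assms(1)] unfolding compactin_def by (metis (no_types, lifting) imageE)
  then obtain X where X: "finite X" "X \<subseteq> \<Omega>" "\<F> = N ` X"
    by (meson finite_subset_image)
  \<comment> \<open>\<open>insert 0\<close> keeps the set nonempty in case \<open>X\<close> is
    empty.\<close>
  define K where "K = Max (insert 0 (k ` X))"
  have "\<bar>f x - f y\<bar> < e" if xy: "x \<in> \<Omega>" "y \<in> \<Omega>" "block K x = block K y" for x y
  proof -
    obtain c where c: "c \<in> X" "x \<in> N c" using F(3) X(3) xy(1) by blast
    have "k c \<le> K" unfolding K_def using X c by (intro Max_ge) auto
    then have "block (k c) y = block (k c) c"
      using c(2) block_eq_mono[OF xy(3)] by (simp add: N_def)
    then have "\<bar>f x - f c\<bar> < e / 2" "\<bar>f y - f c\<bar> < e / 2"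
      using k[of c] c xy X(2) by (auto simp: N_def)
    then show ?thesis by linarith
  qed
  then show ?thesis by blast
qed

text \<open>Values outside \<open>\<Omega>\<close> stay free, and the codomain is arbitrary so that
  the notion covers real functions as well as the vector-valued \<open>\<phi>\<close>.\<close>

definition block_fun :: "(nat \<Rightarrow> 'a) set \<Rightarrow> nat \<Rightarrow> ((nat \<Rightarrow> 'a) \<Rightarrow> 'b) \<Rightarrow> bool" where
  "block_fun \<Omega> k f \<longleftrightarrow> (\<forall>x\<in>\<Omega>. \<forall>y\<in>\<Omega>. block k x = block k y \<longrightarrow> f x = f y)"

lemma block_fun_mono: "block_fun \<Omega> j f \<Longrightarrow> j \<le> k \<Longrightarrow> block_fun \<Omega> k f"
  unfolding block_fun_def using block_eq_mono by metis

lemma block_fun_factor: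
  assumes "block_fun \<Omega> k f"
  obtains f' where "\<And>x. x \<in> \<Omega> \<Longrightarrow> f x = f' (block k x)"
proof
  fix x assume x: "x \<in> \<Omega>"
  have "inv_into \<Omega> (block k) (block k x) \<in> \<Omega>"
    and "block k (inv_into \<Omega> (block k) (block k x)) = block k x"
    using x by (simp_all add: inv_into_into f_inv_into_f)
  then show "f x = (\<lambda>w. f (inv_into \<Omega> (block k) w)) (block k x)"
    using assms x unfolding block_fun_def by metis
qed

lemma block_fun_continuous_map:
  fixes f :: "_ \<Rightarrow> real"
  assumes "block_fun \<Omega> k f"
  shows "continuous_map (subtopology shift_top \<Omega>) euclideanreal f"
  unfolding continuous_map_def
proof (intro conjI allI impI)
  fix U :: "real set"
  show "openin (subtopology shift_top \<Omega>) {x \<in> topspace (subtopology shift_top \<Omega>). f x \<in> U}"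
    unfolding openin_subshift_iff
  proof (intro conjI ballI)
    fix x assume "x \<in> {x \<in> topspace (subtopology shift_top \<Omega>). f x \<in> U}"
    then have x: "x \<in> \<Omega>" "f x \<in> U" by auto
    have "f y \<in> U" if "y \<in> \<Omega>" "block k y = block k x" for y
    proof -
      have "f y = f x" using assms that x(1) unfolding block_fun_def by meson
      then show ?thesis using x(2) by simp
    qed
    then show "\<exists>k. \<forall>y\<in>\<Omega>. block k y = block k x \<longrightarrow>
        y \<in> {x \<in> topspace (subtopology shift_top \<Omega>). f x \<in> U}"
      using x by (intro exI[of _ k]) simp
  qed auto
qed simp

section \<open>Weights of walks in a finite graph\<close>

text \<open>A walk with more than \<open>card V\<close> vertices repeats one of them. Cutting out
  the cycle in between removes a nonnegative weight, and what is left in the end has at most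
  \<open>card V\<close> vertices, each of weight at least \<open>- B\<close>.\<close>

lemma walk_sum_bounded_below:
  fixes w :: "'v \<Rightarrow> real"
  assumes V: "finite V" and B: "\<And>v. v \<in> V \<Longrightarrow> - B \<le> w v" "B \<ge> 0"
    and cyc: "\<And>v bs. set (v # bs) \<subseteq> V \<Longrightarrow> length (v # bs) \<le> card V \<Longrightarrow>
        successively E (v # bs @ [v]) \<Longrightarrow> 0 \<le> sum_list (map w (v # bs))"
  shows "set xs \<subseteq> V \<Longrightarrow> successively E xs \<Longrightarrow> - (B * card V) \<le> sum_list (map w xs)"
proof (induction "length xs" arbitrary: xs rule: less_induct)
  case less
  show ?case
  proof (cases "length xs \<le> card V")
    case True
    have "(\<Sum>_\<leftarrow>xs. - B) \<le> sum_list (map w xs)"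
      using less.prems B by (intro sum_list_mono) auto
    moreover have "- (B * card V) \<le> (\<Sum>_\<leftarrow>xs. - B)"
      using True B(2) by (simp add: sum_list_triv mult.commute mult_left_mono)
    ultimately show ?thesis by linarith
  next
    case False
    \<comment> \<open>The repetition is sought in the first \<open>card V + 1\<close> vertices, so
      that the cycle found has at most \<open>card V\<close> vertices; only finitely many cycles
      then need to be tested.\<close>
    define ys zs where "ys = take (Suc (card V)) xs" and "zs = drop (Suc (card V)) xs"
    have len: "length ys = Suc (card V)" using False by (simp add: ys_def)
    have xs: "xs = ys @ zs" by (simp add: ys_def zs_def)
    have "\<not> distinct ys"
    proof
      assume "distinct ys"
      then have "card (set ys) = Suc (card V)" using len distinct_card by force
      moreover have "card (set ys) \<le> card V"
        using less.prems V xs by (intro card_mono) auto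
      ultimately show False by simp
    qed
    then obtain as bs cs v where ys: "ys = as @ [v] @ bs @ [v] @ cs"
      using not_distinct_decomp by metis
    have suc: "successively E (as @ (v # bs @ [v]) @ cs @ zs)"
      using less.prems(2) by (simp add: xs ys)
    then have "successively E (v # bs @ [v])"
      unfolding successively_append_iff[of E as] successively_append_iff[of E "v # bs @ [v]"]
      by blast
    then have "0 \<le> sum_list (map w (v # bs))"
    proof (rule cyc[rotated 2])
      show "length (v # bs) \<le> card V" using len by (simp add: ys)
    qed (use less.prems in \<open>auto simp: xs ys\<close>)
    moreover have "- (B * card V) \<le> sum_list (map w (as @ v # cs @ zs))"
    proof (rule less.hyps)
      show "successively E (as @ v # cs @ zs)"
        using suc by (auto simp: successively_append_iff successively_Cons split: if_splits)
    qed (use less.prems in \<open>auto simp: xs ys\<close>)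
    ultimately show ?thesis by (simp add: xs ys)
  qed
qed

section \<open>Cycles in the follower-set graph\<close>

lemma language_appendD1: "u @ v \<in> language \<Omega> \<Longrightarrow> u \<in> language \<Omega>"
  by (fastforce simp: language_def cylinder_def nth_append)

lemma language_appendD2:
  assumes "subshift \<Omega>" "u @ v \<in> language \<Omega>"
  shows "v \<in> language \<Omega>"
proof -
  obtain z where z: "z \<in> \<Omega>" "\<And>i. i < length u + length v \<Longrightarrow> z i = (u @ v) ! i"
    using assms(2) by (auto simp: language_def cylinder_def)
  have "(shift ^^ length u) z \<in> cylinder \<Omega> v"
    using z assms(1) by (auto simp: cylinder_def shift_funpow shift_funpow_mem)
  then show ?thesis by (auto simp: language_def)
qed

text \<open>The follower set of a word determines those of its one-letter extensions, so transitions
  can be defined on follower sets alone.\<close>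

lemma follower_set_snoc:
  assumes "subshift \<Omega>"
  shows "follower_set \<Omega> (u @ [a]) = {v. a # v \<in> follower_set \<Omega> u}"
proof (rule set_eqI)
  fix v
  have "u @ a # v \<in> language \<Omega> \<Longrightarrow> a # v \<in> language \<Omega>"
    by (rule language_appendD2[OF assms, of u])
  moreover have "a # v \<in> language \<Omega> \<Longrightarrow> v \<in> language \<Omega>"
    using language_appendD2[OF assms, of "[a]" v] by simp
  ultimately show "v \<in> follower_set \<Omega> (u @ [a]) \<longleftrightarrow> v \<in> {v. a # v \<in> follower_set \<Omega> u}"
    unfolding follower_set_def by simp blast
qed

lemma block_Suc: "block (Suc n) x = block n x @ [x n]"
  by (simp add: block_def)

text \<open>The states of the right-resolving presentation are the follower sets, each paired with
  the next \<open>k\<close> letters, so that a function of \<open>k\<close> coordinates becomes a weight on states.\<close>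

definition states :: "(nat \<Rightarrow> 'a) set \<Rightarrow> nat \<Rightarrow> ('a list set \<times> 'a list) set" where
  "states \<Omega> k = {(S, w). S \<in> range (follower_set \<Omega>) \<and> w \<in> S \<and> length w = k}"

text \<open>An edge reads the first letter of the window: the follower set advances by that letter,
  and consecutive windows overlap as in a de Bruijn graph.\<close>

definition state_edge :: "'a list set \<times> 'a list \<Rightarrow> 'a list set \<times> 'a list \<Rightarrow> bool" where
  "state_edge s t \<longleftrightarrow> fst t = {v. hd (snd s) # v \<in> fst s} \<and> butlast (snd t) = tl (snd s)"

definition state_at :: "(nat \<Rightarrow> 'a) set \<Rightarrow> nat \<Rightarrow> (nat \<Rightarrow> 'a) \<Rightarrow> nat \<Rightarrow> 'a list set \<times> 'a list" where
  "state_at \<Omega> k x n = (follower_set \<Omega> (block n x), block k ((shift ^^ n) x))"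

lemma finite_states:
  assumes "sofic (\<Omega> :: (nat \<Rightarrow> 'a::finite) set)"
  shows "finite (states \<Omega> k)"
proof (rule finite_subset)
  show "states \<Omega> k \<subseteq> range (follower_set \<Omega>) \<times> {w. set w \<subseteq> UNIV \<and> length w = k}"
    by (auto simp: states_def)
  show "finite (range (follower_set \<Omega>) \<times> {w :: 'a list. set w \<subseteq> UNIV \<and> length w = k})"
    using assms by (intro finite_cartesian_product finite_lists_length_eq) (auto simp: sofic_def)
qed

lemma state_at_mem:
  assumes "subshift \<Omega>" "x \<in> \<Omega>"
  shows "state_at \<Omega> k x n \<in> states \<Omega> k"
proof -
  have "block n x @ block k ((shift ^^ n) x) = block (n + k) x"
    by (auto simp: list_eq_iff_nth_eq nth_append shift_funpow)
  then have "block k ((shift ^^ n) x) \<in> follower_set \<Omega> (block n x)"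
    using assms by (simp add: follower_set_def block_mem_language shift_funpow_mem)
  then show ?thesis by (simp add: states_def state_at_def)
qed

lemma state_edge_state_at:
  assumes "subshift \<Omega>" "k > 0"
  shows "state_edge (state_at \<Omega> k x n) (state_at \<Omega> k x (Suc n))"
proof -
  have "hd (block k ((shift ^^ n) x)) = x n"
    using assms(2) by (simp add: hd_conv_nth shift_funpow flip: length_greater_0_conv)
  moreover have "butlast (block k ((shift ^^ Suc n) x)) = tl (block k ((shift ^^ n) x))"
    by (auto simp: list_eq_iff_nth_eq nth_butlast nth_tl shift_funpow simp del: funpow.simps)
  ultimately show ?thesis
    using assms(1) by (simp add: state_edge_def state_at_def block_Suc follower_set_snoc del: funpow.simps)
qed

text \<open>The overlaps force each window to spell the coming letters of \<open>y\<close>.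
  Unrolling the follower-set transitions puts every prefix of \<open>y\<close>, continued by the
  current window, into \<open>fst (z 0)\<close> and so into the language; closedness of
  \<open>\<Omega>\<close> does the rest.\<close>

lemma infinite_walk_label:
  assumes \<Omega>: "subshift \<Omega>" and k: "k > 0"
    and z: "\<And>n. z n \<in> states \<Omega> k" "\<And>n. state_edge (z n) (z (Suc n))"
  defines "y \<equiv> \<lambda>n. hd (snd (z n))"
  shows "y \<in> \<Omega>" and "block k ((shift ^^ n) y) = snd (z n)"
proof -
  have len: "length (snd (z n)) = k" for n
    using z(1)[of n] by (auto simp: states_def)
  have nth: "snd (z n) ! j = y (n + j)" if "j < k" for n j
    using that
  proof (induction j arbitrary: n)
    case 0
    then show ?case using len[of n] by (auto simp: y_def hd_conv_nth)
  next
    case (Suc j)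
    have "snd (z n) ! Suc j = tl (snd (z n)) ! j"
      using Suc.prems len by (simp add: nth_tl)
    also have "\<dots> = butlast (snd (z (Suc n))) ! j"
      using z(2)[of n] by (simp add: state_edge_def)
    also have "\<dots> = snd (z (Suc n)) ! j"
      using Suc.prems len by (simp add: nth_butlast)
    finally show ?case using Suc.IH[of "Suc n"] Suc.prems by simp
  qed
  then show "block k ((shift ^^ n) y) = snd (z n)"
    by (auto simp: list_eq_iff_nth_eq len shift_funpow)
  have foll: "v \<in> fst (z n) \<longleftrightarrow> block n y @ v \<in> fst (z 0)" for n v
  proof (induction n arbitrary: v)
    case 0
    then show ?case by (simp add: block_def)
  next
    case (Suc n)
    have "v \<in> fst (z (Suc n)) \<longleftrightarrow> y n # v \<in> fst (z n)"
      using z(2)[of n] by (simp add: state_edge_def y_def)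
    then show ?case by (simp add: Suc.IH block_Suc)
  qed
  show "y \<in> \<Omega>"
  proof (rule mem_subshiftI[OF \<Omega>])
    fix n
    have "snd (z n) \<in> fst (z n)" using z(1)[of n] by (auto simp: states_def)
    then have "block n y @ snd (z n) \<in> fst (z 0)" using foll[of _ n] by blast
    moreover have "fst (z 0) \<subseteq> language \<Omega>"
      using z(1)[of 0] by (auto simp: states_def follower_set_def)
    ultimately show "block n y \<in> language \<Omega>" using language_appendD1 by blast
  qed
qed

text \<open>\<open>Y\<close> lists the points spelled by short closed walks, and the weight of such
  a walk is the Birkhoff sum of \<open>G\<close> along it. \<open>Y\<close> is fixed before
  \<open>G\<close>, so that \<open>G\<close> can later be a functional separating a measure from the
  averages over \<open>Y\<close>.\<close>

lemma periodic_points_control_birkhoff_sums: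
  fixes \<Omega> :: "(nat \<Rightarrow> 'a::finite) set"
  assumes \<Omega>: "subshift \<Omega>" "sofic \<Omega>" and k: "k > 0"
  shows "\<exists>Y. finite Y \<and> (\<forall>(y, p)\<in>Y. y \<in> \<Omega> \<and> p > 0 \<and> (shift ^^ p) y = y) \<and>
    (\<forall>G :: _ \<Rightarrow> real. block_fun \<Omega> k G \<longrightarrow> (\<forall>(y, p)\<in>Y. 0 \<le> (\<Sum>i<p. G ((shift ^^ i) y))) \<longrightarrow>
       (\<exists>K. \<forall>x\<in>\<Omega>. \<forall>N. - K \<le> (\<Sum>n<N. G ((shift ^^ n) x))))"
proof -
  define V where "V = states \<Omega> k"
  \<comment> \<open>Appending \<open>hd cs\<close> brings in the closing edge; the bound on the
    length makes the family finite.\<close>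
  define \<C> where "\<C> = {cs. set cs \<subseteq> V \<and> length cs \<le> card V \<and> cs \<noteq> [] \<and> successively state_edge (cs @ [hd cs])}"
  define z where "z cs n = cs ! (n mod length cs)" for cs :: "('a list set \<times> 'a list) list" and n
  define y where "y cs = (\<lambda>n. hd (snd (z cs n)))" for cs
  have V: "finite V" by (simp add: V_def finite_states \<Omega>)
  have z_mem: "z cs n \<in> states \<Omega> k" and z_edge: "state_edge (z cs n) (z cs (Suc n))"
    if cs: "cs \<in> \<C>" for cs n
  proof -
    have p: "n mod length cs < length cs" using cs by (simp add: \<C>_def)
    then show "z cs n \<in> states \<Omega> k" using cs by (auto simp: \<C>_def z_def V_def)
    have "successively state_edge (cs @ [hd cs])" using cs by (simp add: \<C>_def)
    then have "state_edge ((cs @ [hd cs]) ! (n mod length cs)) ((cs @ [hd cs]) ! Suc (n mod length cs))"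
      using p by (simp add: successively_conv_nth)
    then show "state_edge (z cs n) (z cs (Suc n))"
      using p hd_conv_nth[of cs] cs
      by (cases "Suc (n mod length cs) = length cs") (auto simp: \<C>_def z_def nth_append mod_Suc)
  qed
  have y_mem: "y cs \<in> \<Omega>" and y_block: "block k ((shift ^^ n) (y cs)) = snd (z cs n)"
    if "cs \<in> \<C>" for cs n
    unfolding y_def
    by (rule infinite_walk_label[where z = "z cs", OF \<Omega>(1) k z_mem[OF that] z_edge[OF that]])+
  define Y where "Y = (\<lambda>cs. (y cs, length cs)) ` \<C>"
  have "finite \<C>"
    by (rule finite_subset[OF _ finite_lists_length_le[OF V, of "card V"]]) (auto simp: \<C>_def)
  then have "finite Y" by (simp add: Y_def)
  moreover have "y cs \<in> \<Omega> \<and> length cs > 0 \<and> (shift ^^ length cs) (y cs) = y cs" if "cs \<in> \<C>" for cs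
    using y_mem[OF that] that by (auto simp: \<C>_def fun_eq_iff shift_funpow y_def z_def)
  moreover have "\<exists>K. \<forall>x\<in>\<Omega>. \<forall>N. - K \<le> (\<Sum>n<N. G ((shift ^^ n) x))"
    if G: "block_fun \<Omega> k G" and pos: "\<And>cs. cs \<in> \<C> \<Longrightarrow> 0 \<le> (\<Sum>i<length cs. G ((shift ^^ i) (y cs)))"
    for G :: "_ \<Rightarrow> real"
  proof -
    obtain g where g: "\<And>x. x \<in> \<Omega> \<Longrightarrow> G x = g (block k x)" using block_fun_factor[OF G] by blast
    \<comment> \<open>A crude bound: one weight is dominated by the sum of all absolute
      values.\<close>
    define B where "B = (\<Sum>v\<in>V. \<bar>g (snd v)\<bar>)"
    have B: "- B \<le> g (snd v)" if "v \<in> V" for v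
      using member_le_sum[of v V "\<lambda>v. \<bar>g (snd v)\<bar>"] that V by (simp add: B_def)
    have "- (B * card V) \<le> (\<Sum>n<N. G ((shift ^^ n) x))" if x: "x \<in> \<Omega>" for x N
    proof -
      have "- (B * card V) \<le> sum_list (map (\<lambda>v. g (snd v)) (map (state_at \<Omega> k x) [0..<N]))"
      proof (rule walk_sum_bounded_below[OF V B, where E = state_edge])
        show "B \<ge> 0" by (simp add: B_def sum_nonneg)
        show "set (map (state_at \<Omega> k x) [0..<N]) \<subseteq> V"
          using state_at_mem[OF \<Omega>(1) x] by (auto simp: V_def)
        show "successively state_edge (map (state_at \<Omega> k x) [0..<N])"
          using state_edge_state_at[OF \<Omega>(1) k] by (simp add: successively_conv_nth)
        fix v bs
        assume "set (v # bs) \<subseteq> V" "length (v # bs) \<le> card V" "successively state_edge (v # bs @ [v])"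
        then have cs: "v # bs \<in> \<C>" by (simp add: \<C>_def)
        have "G ((shift ^^ i) (y (v # bs))) = g (snd ((v # bs) ! i))" if "i < length (v # bs)" for i
          using g[OF shift_funpow_mem[OF \<Omega>(1) y_mem[OF cs]]] y_block[OF cs] that
          by (simp add: z_def)
        then have "(\<Sum>i<length (v # bs). G ((shift ^^ i) (y (v # bs)))) = sum_list (map (\<lambda>v. g (snd v)) (v # bs))"
          unfolding sum_list_sum_nth length_map atLeast0LessThan by (intro sum.cong) (simp_all del: list.map)
        then show "0 \<le> sum_list (map (\<lambda>v. g (snd v)) (v # bs))"
          using pos[OF cs] by simp
      qed auto
      also have "\<dots> = (\<Sum>n<N. G ((shift ^^ n) x))"
        using g[OF shift_funpow_mem[OF \<Omega>(1) x]]
        by (simp add: sum_list_sum_nth atLeast0LessThan state_at_def)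
      finally show ?thesis .
    qed
    then show ?thesis by blast
  qed
  ultimately show ?thesis
    unfolding Y_def by (intro exI[of _ "(\<lambda>cs. (y cs, length cs)) ` \<C>"]) blast
qed

section \<open>Invariant measures\<close>

lemma space_borel_shift [simp]: "space (borel_shift \<Omega>) = \<Omega>"
  unfolding borel_shift_def by (rule space_measure_of) (auto simp: openin_subshift_iff)

lemma sets_borel_shift: "sets (borel_shift \<Omega>) = sigma_sets \<Omega> {U. openin (subtopology shift_top \<Omega>) U}"
  unfolding borel_shift_def by (rule sets_measure_of) (auto simp: openin_subshift_iff)

lemma openin_sets_borel_shift:
  "openin (subtopology shift_top \<Omega>) U \<Longrightarrow> U \<in> sets (borel_shift \<Omega>)"
  unfolding sets_borel_shift by (rule sigma_sets.Basic) simp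

lemma openin_block_set: "openin (subtopology shift_top \<Omega>) {x \<in> \<Omega>. block k x \<in> W}"
  unfolding openin_subshift_iff
proof (intro conjI ballI)
  fix x assume "x \<in> {x \<in> \<Omega>. block k x \<in> W}"
  then show "\<exists>j. \<forall>y\<in>\<Omega>. block j y = block j x \<longrightarrow> y \<in> {x \<in> \<Omega>. block k x \<in> W}"
    by (intro exI[of _ k]) simp
qed simp

lemma block_set_measurable: "{x \<in> \<Omega>. block k x \<in> W} \<in> sets (borel_shift \<Omega>)"
  by (intro openin_sets_borel_shift openin_block_set)

lemma continuous_map_measurable:
  fixes f :: "_ \<Rightarrow> real"
  assumes f: "continuous_map (subtopology shift_top \<Omega>) euclideanreal f"
  shows "f \<in> borel_measurable (borel_shift \<Omega>)"
proof (rule borel_measurableI)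
  fix S :: "real set" assume "open S"
  then have "openin (subtopology shift_top \<Omega>) {x \<in> topspace (subtopology shift_top \<Omega>). f x \<in> S}"
    by (intro openin_continuous_map_preimage[OF f]) simp
  moreover have "f -` S \<inter> space (borel_shift \<Omega>) = {x \<in> topspace (subtopology shift_top \<Omega>). f x \<in> S}"
    by auto
  ultimately show "f -` S \<inter> space (borel_shift \<Omega>) \<in> sets (borel_shift \<Omega>)"
    using openin_sets_borel_shift by simp
qed

lemma block_fun_measurable:
  fixes f :: "_ \<Rightarrow> real"
  shows "block_fun \<Omega> k f \<Longrightarrow> f \<in> borel_measurable (borel_shift \<Omega>)"
  by (intro continuous_map_measurable block_fun_continuous_map)

lemma continuous_map_bounded:
  fixes \<Omega> :: "(nat \<Rightarrow> 'a::finite) set" and f :: "_ \<Rightarrow> real"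
  assumes "subshift \<Omega>" and "continuous_map (subtopology shift_top \<Omega>) euclideanreal f"
  shows "\<exists>B. \<forall>x\<in>\<Omega>. \<bar>f x\<bar> \<le> B"
proof -
  have "compactin (subtopology shift_top \<Omega>) \<Omega>"
    using compactin_subshift[OF assms(1)] by (simp add: compactin_subtopology)
  then have "compactin euclideanreal (f ` \<Omega>)"
    by (rule image_compactin[OF _ assms(2)])
  then have "bounded (f ` \<Omega>)" by (simp add: compact_imp_bounded)
  then show ?thesis by (auto simp: bounded_iff)
qed

lemma shift_measurable:
  assumes "subshift \<Omega>"
  shows "shift \<in> measurable (borel_shift \<Omega>) (borel_shift \<Omega>)"
  unfolding borel_shift_def
proof (rule measurable_measure_of)
  show "shift \<in> space (sigma \<Omega> {U. openin (subtopology shift_top \<Omega>) U}) \<rightarrow> \<Omega>"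
    using shift_mem[OF assms] space_borel_shift[of \<Omega>] unfolding borel_shift_def by auto
  fix U assume "U \<in> {U. openin (subtopology shift_top \<Omega>) U}"
  then have U: "\<And>x. x \<in> U \<Longrightarrow> \<exists>k. \<forall>y\<in>\<Omega>. block k y = block k x \<longrightarrow> y \<in> U"
    by (simp add: openin_subshift_iff)
  have "openin (subtopology shift_top \<Omega>) {x \<in> \<Omega>. shift x \<in> U}"
    unfolding openin_subshift_iff
  proof (intro conjI ballI)
    fix x assume x: "x \<in> {x \<in> \<Omega>. shift x \<in> U}"
    then obtain k where k: "\<And>y. y \<in> \<Omega> \<Longrightarrow> block k y = block k (shift x) \<Longrightarrow> y \<in> U"
      using U[of "shift x"] by auto
    \<comment> \<open>The shift drops the first letter, so the block has to be one letter
      longer.\<close>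
    have "shift y \<in> U" if "y \<in> \<Omega>" "block (Suc k) y = block (Suc k) x" for y
      using that k[of "shift y"] shift_mem[OF assms] by (simp add: block_eq_iff shift_def)
    then show "\<exists>k. \<forall>y\<in>\<Omega>. block k y = block k x \<longrightarrow> y \<in> {x \<in> \<Omega>. shift x \<in> U}"
      by (intro exI[of _ "Suc k"]) simp
  qed simp
  moreover have "shift -` U \<inter> \<Omega> = {x \<in> \<Omega>. shift x \<in> U}" by auto
  ultimately show "shift -` U \<inter> space (sigma \<Omega> {U. openin (subtopology shift_top \<Omega>) U})
      \<in> sets (sigma \<Omega> {U. openin (subtopology shift_top \<Omega>) U})"
    using openin_sets_borel_shift space_borel_shift[of \<Omega>] unfolding borel_shift_def by simp
qed (auto simp: openin_subshift_iff)

locale invariant_measure =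
  fixes \<Omega> :: "(nat \<Rightarrow> 'a::finite) set" and M :: "(nat \<Rightarrow> 'a) measure"
  assumes \<Omega>: "subshift \<Omega>" and M: "M \<in> inv_measures \<Omega>"
begin

lemma sets_M: "sets M = sets (borel_shift \<Omega>)"
  using M by (simp add: inv_measures_def)

lemma space_M [simp]: "space M = \<Omega>"
  using sets_eq_imp_space_eq[OF sets_M] by simp

sublocale prob_space M
  using M by (simp add: inv_measures_def)

lemma measurable_M_iff: "measurable M N = measurable (borel_shift \<Omega>) N"
  by (rule measurable_cong_sets) (simp_all add: sets_M)

lemma shift_measurable_M: "shift \<in> measurable M M"
  using shift_measurable[OF \<Omega>] sets_M measurable_cong_sets[OF sets_M sets_M] by simp

lemma shift_funpow_measurable: "(shift ^^ n) \<in> measurable M M"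
proof (induction n)
  case (Suc n)
  then show ?case using measurable_comp[OF Suc shift_measurable_M] by (simp add: comp_def)
qed (simp add: id_def)

lemma distr_shift: "distr M M shift = M"
proof (rule measure_eqI)
  fix A assume "A \<in> sets (distr M M shift)"
  then have A: "A \<in> sets M" by simp
  have "emeasure (distr M M shift) A = emeasure M (shift -` A \<inter> space M)"
    by (rule emeasure_distr[OF shift_measurable_M A])
  also have "shift -` A \<inter> space M = {x \<in> \<Omega>. shift x \<in> A}" by auto
  also have "emeasure M \<dots> = emeasure M A" using M A by (simp add: inv_measures_def)
  finally show "emeasure (distr M M shift) A = emeasure M A" .
qed simp

lemma distr_shift_funpow: "distr M M (shift ^^ n) = M"
proof (induction n)
  case 0
  show ?case using distr_id[of M] by (simp add: id_def)
next
  case (Suc n)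
  have "distr M M (shift ^^ Suc n) = distr (distr M M (shift ^^ n)) M shift"
    using distr_distr[OF shift_measurable_M shift_funpow_measurable, of n] by (simp add: comp_def)
  then show ?case using Suc distr_shift by (simp add: comp_def)
qed

lemma integral_shift_funpow:
  fixes f :: "_ \<Rightarrow> real"
  assumes "f \<in> borel_measurable M"
  shows "(\<integral>x. f ((shift ^^ n) x) \<partial>M) = (\<integral>x. f x \<partial>M)"
  using integral_distr[OF shift_funpow_measurable assms, of n] by (simp add: distr_shift_funpow)

lemma measure_shift_funpow:
  assumes "A \<in> sets M"
  shows "measure M {x \<in> \<Omega>. (shift ^^ n) x \<in> A} = measure M A"
proof -
  have "measure M A = measure (distr M M (shift ^^ n)) A" by (simp add: distr_shift_funpow)
  also have "\<dots> = measure M ((shift ^^ n) -` A \<inter> space M)"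
    by (rule measure_distr[OF shift_funpow_measurable assms])
  also have "(shift ^^ n) -` A \<inter> space M = {x \<in> \<Omega>. (shift ^^ n) x \<in> A}" by auto
  finally show ?thesis by simp
qed

lemma integrable_continuous:
  fixes f :: "_ \<Rightarrow> real"
  assumes f: "continuous_map (subtopology shift_top \<Omega>) euclideanreal f"
  shows "integrable M f"
proof -
  obtain B where "\<And>x. x \<in> \<Omega> \<Longrightarrow> \<bar>f x\<bar> \<le> B" using continuous_map_bounded[OF \<Omega> f] by auto
  then show ?thesis
    using continuous_map_measurable[OF f]
    by (intro integrable_const_bound[of _ B]) (auto simp: measurable_M_iff)
qed

lemma integrable_block_fun:
  fixes f :: "_ \<Rightarrow> real"
  shows "block_fun \<Omega> k f \<Longrightarrow> integrable M f"
  by (intro integrable_continuous block_fun_continuous_map)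

text \<open>By invariance the sum over \<open>N\<close> steps has integral \<open>N\<close> times
  that of \<open>G\<close>; a negative integral of \<open>G\<close> would push it below
  \<open>- K\<close> for large \<open>N\<close>.\<close>

lemma integral_nonneg_of_birkhoff_bounded_below:
  fixes G :: "_ \<Rightarrow> real"
  assumes G: "integrable M G" and K: "\<And>x N. x \<in> \<Omega> \<Longrightarrow> - K \<le> (\<Sum>n<N. G ((shift ^^ n) x))"
  shows "0 \<le> (\<integral>x. G x \<partial>M)"
proof (rule ccontr)
  assume "\<not> 0 \<le> (\<integral>x. G x \<partial>M)"
  then obtain N :: nat where N: "K < real N * - (\<integral>x. G x \<partial>M)"
    using reals_Archimedean3[of "- (\<integral>x. G x \<partial>M)"] by auto
  have meas: "G \<in> borel_measurable M" using G by simp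
  have int: "integrable M (\<lambda>x. G ((shift ^^ n) x))" for n
    using integrable_distr[OF shift_funpow_measurable, of n G] G by (simp add: distr_shift_funpow)
  have "- K = (\<integral>x. - K \<partial>M)" using prob_space by simp
  also have "\<dots> \<le> (\<integral>x. (\<Sum>n<N. G ((shift ^^ n) x)) \<partial>M)"
    using K int by (intro integral_mono) auto
  also have "\<dots> = real N * (\<integral>x. G x \<partial>M)"
    using int by (simp add: Bochner_Integration.integral_sum integral_shift_funpow[OF meas])
  finally show False using N by simp
qed

end

section \<open>Invariant measures carried by periodic orbits\<close>

lemma pmf_with_weights:
  assumes "finite C" "\<And>v. v \<in> C \<Longrightarrow> 0 \<le> u v" "sum u C = 1"
  obtains Q where "set_pmf Q \<subseteq> C" "\<And>v. v \<in> C \<Longrightarrow> pmf Q v = u v"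
proof -
  define u' where "u' v = (if v \<in> C then u v else 0)" for v
  have "(\<integral>\<^sup>+ v. ennreal (u' v) \<partial>count_space UNIV) = (\<Sum>v\<in>C. ennreal (u' v))"
    using assms(1) by (intro nn_integral_count_space') (auto simp: u'_def)
  also have "\<dots> = ennreal (\<Sum>v\<in>C. u v)"
    using assms(2) by (subst sum_ennreal[symmetric]) (auto simp: u'_def)
  finally have 1: "(\<integral>\<^sup>+ v. ennreal (u' v) \<partial>count_space UNIV) = 1" using assms(3) by simp
  have "pmf (embed_pmf u') v = u' v" for v
    using assms(2) 1 by (intro pmf_embed_pmf) (auto simp: u'_def)
  then show ?thesis
    by (intro that[of "embed_pmf u'"]) (auto simp: u'_def set_pmf_iff split: if_splits)
qed

text \<open>A \<open>pmf\<close> measures all sets of sequences, while a member of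
  \<open>inv_measures\<close> has space \<open>\<Omega>\<close> and its Borel sets. As
  \<open>P\<close> is carried by \<open>\<Omega>\<close>, the transfer changes no mass of a Borel
  set.\<close>

lemma pmf_invariant_measure:
  assumes \<Omega>: "subshift \<Omega>" and P: "set_pmf P \<subseteq> \<Omega>" and inv: "map_pmf shift P = P"
  obtains \<nu> where "\<nu> \<in> inv_measures \<Omega>"
    "\<And>f :: _ \<Rightarrow> real. f \<in> borel_measurable (borel_shift \<Omega>) \<Longrightarrow>
       (\<integral>x. f x \<partial>\<nu>) = measure_pmf.expectation P f"
proof -
  obtain x0 where x0: "x0 \<in> \<Omega>" using P set_pmf_not_empty[of P] by blast
  \<comment> \<open>\<open>T\<close> sends points outside \<open>\<Omega>\<close> to
    \<open>x0\<close> merely to map into \<open>\<Omega>\<close>; almost surely it is the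
    identity.\<close>
  define T where "T x = (if x \<in> \<Omega> then x else x0)" for x
  define \<nu> where "\<nu> = distr (measure_pmf P) (borel_shift \<Omega>) T"
  have T: "T \<in> measurable (measure_pmf P) (borel_shift \<Omega>)" by (simp add: T_def x0)
  have AE_T: "AE x in measure_pmf P. T x = x"
    using P by (auto simp: AE_measure_pmf_iff T_def)
  have em: "emeasure \<nu> A = emeasure (measure_pmf P) A" if "A \<in> sets (borel_shift \<Omega>)" for A
  proof -
    have "emeasure \<nu> A = emeasure (measure_pmf P) (T -` A)"
      unfolding \<nu>_def using emeasure_distr[OF T that] by simp
    also have "\<dots> = emeasure (measure_pmf P) A"
      using AE_T by (intro emeasure_eq_AE) auto
    finally show ?thesis .
  qed
  show ?thesis
  proof
    show "\<nu> \<in> inv_measures \<Omega>"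
      unfolding inv_measures_def
    proof (intro CollectI conjI ballI)
      show sets: "sets \<nu> = sets (borel_shift \<Omega>)" by (simp add: \<nu>_def)
      show "prob_space \<nu>" unfolding \<nu>_def by (rule measure_pmf.prob_space_distr[OF T])
      fix A assume "A \<in> sets \<nu>"
      then have A: "A \<in> sets (borel_shift \<Omega>)" by (simp add: sets)
      have "shift -` A \<inter> space (borel_shift \<Omega>) \<in> sets (borel_shift \<Omega>)"
        by (rule measurable_sets[OF shift_measurable[OF \<Omega>] A])
      also have "shift -` A \<inter> space (borel_shift \<Omega>) = {x \<in> \<Omega>. shift x \<in> A}" by auto
      finally have "emeasure \<nu> {x \<in> \<Omega>. shift x \<in> A} = emeasure (measure_pmf P) {x \<in> \<Omega>. shift x \<in> A}"
        by (rule em)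
      also have "\<dots> = emeasure (measure_pmf P) (shift -` A)"
        using P by (intro emeasure_eq_AE) (auto simp: AE_measure_pmf_iff)
      also have "\<dots> = emeasure (measure_pmf (map_pmf shift P)) A" by simp
      finally show "emeasure \<nu> {x \<in> \<Omega>. shift x \<in> A} = emeasure \<nu> A"
        using em[OF A] inv by simp
    qed
    fix f :: "_ \<Rightarrow> real" assume f: "f \<in> borel_measurable (borel_shift \<Omega>)"
    have "(\<integral>x. f x \<partial>\<nu>) = measure_pmf.expectation P (\<lambda>x. f (T x))"
      unfolding \<nu>_def by (rule integral_distr[OF T f])
    also have "\<dots> = measure_pmf.expectation P f"
      using AE_T by (intro integral_cong_AE) auto
    finally show "(\<integral>x. f x \<partial>\<nu>) = measure_pmf.expectation P f" .
  qed
qed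

text \<open>The uniform measure on a periodic orbit. If \<open>p\<close> is a multiple of the least
  period, every point is counted equally often and the law is the same.\<close>

definition orbit_pmf :: "(nat \<Rightarrow> 'a) \<Rightarrow> nat \<Rightarrow> (nat \<Rightarrow> 'a) pmf" where
  "orbit_pmf y p = map_pmf (\<lambda>i. (shift ^^ i) y) (pmf_of_set {..<p})"

text \<open>On indices the shift acts as the rotation \<open>Suc i mod p\<close>, which preserves
  the uniform law.\<close>

lemma orbit_pmf_invariant:
  assumes "p > 0" "(shift ^^ p) y = y"
  shows "map_pmf shift (orbit_pmf y p) = orbit_pmf y p"
proof -
  have bij: "bij_betw (\<lambda>i. Suc i mod p) {..<p} {..<p}"
  proof (rule bij_betwI[where g = "\<lambda>i. if i = 0 then p - 1 else i - 1"])
  qed (use assms(1) in \<open>auto simp: mod_Suc\<close>)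
  have "shift ((shift ^^ i) y) = (shift ^^ (Suc i mod p)) y" if "i < p" for i
    using that assms(2) by (auto simp: mod_Suc simp flip: funpow.simps(2)[THEN fun_cong, simplified])
  then have "map_pmf shift (orbit_pmf y p) = map_pmf (\<lambda>i. (shift ^^ (Suc i mod p)) y) (pmf_of_set {..<p})"
    unfolding orbit_pmf_def pmf.map_comp using assms(1)
    by (intro map_pmf_cong) (auto simp: lessThan_empty_iff)
  also have "\<dots> = map_pmf (\<lambda>i. (shift ^^ i) y) (map_pmf (\<lambda>i. Suc i mod p) (pmf_of_set {..<p}))"
    by (simp add: pmf.map_comp comp_def)
  also have "map_pmf (\<lambda>i. Suc i mod p) (pmf_of_set {..<p}) = pmf_of_set {..<p}"
    using assms(1) by (intro map_pmf_of_set_bij_betw bij) (auto simp: lessThan_empty_iff)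
  finally show ?thesis by (simp add: orbit_pmf_def)
qed

lemma expectation_orbit_pmf:
  fixes f :: "_ \<Rightarrow> real"
  assumes "p > 0"
  shows "measure_pmf.expectation (orbit_pmf y p) f = (\<Sum>i<p. f ((shift ^^ i) y)) / p"
  using assms by (simp add: orbit_pmf_def integral_pmf_of_set lessThan_empty_iff)

lemma set_orbit_pmf: "p > 0 \<Longrightarrow> set_pmf (orbit_pmf y p) = (\<lambda>i. (shift ^^ i) y) ` {..<p}"
  by (simp add: orbit_pmf_def lessThan_empty_iff)

section \<open>Relative maximizing measures of block functions\<close>

lemma locally_constant_block_fun:
  fixes \<phi> :: "(nat \<Rightarrow> 'a) \<Rightarrow> real ^ 'd"
  assumes "locally_constant \<Omega> \<phi>"
  obtains k where "block_fun \<Omega> k \<phi>"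
proof -
  obtain K where K: "\<And>i x y. x \<in> \<Omega> \<Longrightarrow> y \<in> \<Omega> \<Longrightarrow> (\<And>j. j \<le> K i \<Longrightarrow> x j = y j) \<Longrightarrow> \<phi> x $ i = \<phi> y $ i"
    using assms unfolding locally_constant_def by metis
  \<comment> \<open>The index type is finite, so the maximum exists; \<open>Suc\<close> turns the
    bound \<open>j \<le> K i\<close> into the strict one used by blocks.\<close>
  define k where "k = Suc (Max (range K))"
  have "block_fun \<Omega> k \<phi>"
    unfolding block_fun_def
  proof (intro ballI impI)
    fix x y assume xy: "x \<in> \<Omega>" "y \<in> \<Omega>" "block k x = block k y"
    have "\<phi> x $ i = \<phi> y $ i" for i
    proof (rule K[OF xy(1,2)])
      fix j assume "j \<le> K i"
      also have "K i \<le> Max (range K)" by simp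
      finally show "x j = y j" using xy(3) by (simp add: block_eq_iff k_def)
    qed
    then show "\<phi> x = \<phi> y" by (simp add: vec_eq_iff)
  qed
  then show ?thesis by (rule that)
qed

text \<open>The objective and the constraint are kept in one vector, so that a single polytope
  governs both.\<close>

definition cycle_average :: "((nat \<Rightarrow> 'a) \<Rightarrow> real) \<Rightarrow> ((nat \<Rightarrow> 'a) \<Rightarrow> real ^ 'd) \<Rightarrow>
    (nat \<Rightarrow> 'a) \<times> nat \<Rightarrow> real \<times> (real ^ 'd)" where
  "cycle_average f \<phi> = (\<lambda>(y, p). (\<Sum>i<p. (f ((shift ^^ i) y), \<phi> ((shift ^^ i) y))) /\<^sub>R p)"

lemma block_fun_linear:
  fixes f :: "_ \<Rightarrow> real" and \<phi> :: "_ \<Rightarrow> real ^ 'd"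
  assumes "block_fun \<Omega> k f" "block_fun \<Omega> k \<phi>"
  shows "block_fun \<Omega> k (\<lambda>x. a \<bullet> (f x, \<phi> x) - b)"
  using assms unfolding block_fun_def by metis

lemma (in invariant_measure) integral_inner_rot_vec:
  fixes f :: "_ \<Rightarrow> real" and \<phi> :: "_ \<Rightarrow> real ^ 'd"
  assumes f: "block_fun \<Omega> k f" and \<phi>: "block_fun \<Omega> k \<phi>"
  shows "(\<integral>x. a \<bullet> (f x, \<phi> x) - b \<partial>M) = a \<bullet> (\<integral>x. f x \<partial>M, rot_vec \<phi> M) - b"
proof -
  have "block_fun \<Omega> k (\<lambda>x. \<phi> x $ i)" for i
    using \<phi> unfolding block_fun_def by metis
  then have int: "integrable M (\<lambda>x. \<phi> x $ i)" "integrable M f" for i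
    using f integrable_block_fun by blast+
  have "(\<integral>x. a \<bullet> (f x, \<phi> x) - b \<partial>M) = (\<integral>x. fst a * f x + (\<Sum>i\<in>UNIV. snd a $ i * \<phi> x $ i) - b \<partial>M)"
    by (simp add: inner_prod_def inner_vec_def)
  also have "\<dots> = fst a * (\<integral>x. f x \<partial>M) + (\<Sum>i\<in>UNIV. snd a $ i * (\<integral>x. \<phi> x $ i \<partial>M)) - b"
    using int prob_space by (simp add: Bochner_Integration.integral_sum)
  finally show ?thesis
    by (simp add: inner_prod_def inner_vec_def rot_vec_def)
qed

text \<open>A linear program: all vectors of invariant measures lie in the polytope \<open>H\<close>
  spanned by the cycle averages, and the best point of \<open>H\<close> over \<open>h\<close> is
  realised by a mixture of orbit measures. That \<open>Z\<close> carries \<open>\<nu>\<close> is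
  expressed through integrals, the form in which it is applied to a penalty vanishing on
  \<open>Z\<close>.\<close>

lemma relative_maximizer_finite_support:
  fixes \<Omega> :: "(nat \<Rightarrow> 'a::finite) set" and \<phi> :: "(nat \<Rightarrow> 'a) \<Rightarrow> real ^ 'd"
    and f :: "(nat \<Rightarrow> 'a) \<Rightarrow> real"
  assumes \<Omega>: "subshift \<Omega>" "sofic \<Omega>" and lc: "locally_constant \<Omega> \<phi>" and h: "h \<in> rot_set \<Omega> \<phi>"
    and f0: "block_fun \<Omega> j f"
  obtains \<nu> Z where "\<nu> \<in> inv_measures \<Omega>" "rot_vec \<phi> \<nu> = h"
    "\<And>M. M \<in> inv_measures \<Omega> \<Longrightarrow> rot_vec \<phi> M = h \<Longrightarrow> (\<integral>x. f x \<partial>M) \<le> (\<integral>x. f x \<partial>\<nu>)"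
    "finite Z" "Z \<noteq> {}"
    "\<And>g :: _ \<Rightarrow> real. g \<in> borel_measurable (borel_shift \<Omega>) \<Longrightarrow> (\<And>x. x \<in> Z \<Longrightarrow> g x = 0) \<Longrightarrow>
       (\<integral>x. g x \<partial>\<nu>) = 0"
proof -
  obtain k0 where k0: "block_fun \<Omega> k0 \<phi>" using locally_constant_block_fun[OF lc] .
  \<comment> \<open>\<open>Suc\<close> secures a nonempty window, whose head labels the
    edges.\<close>
  define k where "k = Suc (max j k0)"
  have k: "k > 0" and f: "block_fun \<Omega> k f" and \<phi>: "block_fun \<Omega> k \<phi>"
    using block_fun_mono[OF f0, of k] block_fun_mono[OF k0, of k] by (simp_all add: k_def)
  have \<phi>i: "block_fun \<Omega> k (\<lambda>x. \<phi> x $ i)" for i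
    using \<phi> unfolding block_fun_def by metis
  obtain Y where Y: "finite Y" "\<And>y p. (y, p) \<in> Y \<Longrightarrow> y \<in> \<Omega> \<and> p > 0 \<and> (shift ^^ p) y = y"
    and Y_control: "\<And>G :: _ \<Rightarrow> real. block_fun \<Omega> k G \<Longrightarrow>
      (\<And>y p. (y, p) \<in> Y \<Longrightarrow> 0 \<le> (\<Sum>i<p. G ((shift ^^ i) y))) \<Longrightarrow>
      \<exists>K. \<forall>x\<in>\<Omega>. \<forall>N. - K \<le> (\<Sum>n<N. G ((shift ^^ n) x))"
    using periodic_points_control_birkhoff_sums[OF \<Omega> k] by fast
  define c where "c = cycle_average f \<phi>"
  define H where "H = convex hull (c ` Y)"
  have H: "compact H" "convex H"
    unfolding H_def using Y(1) by (simp_all add: finite_imp_compact_convex_hull)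
  have in_H: "(\<integral>x. f x \<partial>M, rot_vec \<phi> M) \<in> H" if M: "M \<in> inv_measures \<Omega>" for M
  proof (rule ccontr)
    interpret invariant_measure \<Omega> M using \<Omega>(1) M by unfold_locales
    assume "(\<integral>x. f x \<partial>M, rot_vec \<phi> M) \<notin> H"
    then obtain a b where ab: "a \<bullet> (\<integral>x. f x \<partial>M, rot_vec \<phi> M) < b" "\<And>v. v \<in> H \<Longrightarrow> a \<bullet> v > b"
      using separating_hyperplane_closed_point[OF H(2) compact_imp_closed[OF H(1)]] by metis
    define G where "G x = a \<bullet> (f x, \<phi> x) - b" for x
    have G: "block_fun \<Omega> k G" unfolding G_def by (rule block_fun_linear[OF f \<phi>])
    have "0 \<le> (\<Sum>i<p. G ((shift ^^ i) y))" if yp: "(y, p) \<in> Y" for y p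
    proof -
      have "c (y, p) \<in> H" unfolding H_def using yp by (intro hull_inc) auto
      then have "b < a \<bullet> c (y, p)" by (rule ab(2))
      also have "a \<bullet> c (y, p) = (\<Sum>i<p. a \<bullet> (f ((shift ^^ i) y), \<phi> ((shift ^^ i) y))) / p"
        by (simp add: c_def cycle_average_def inner_sum_right divide_inverse mult.commute)
      finally have "b * p < (\<Sum>i<p. a \<bullet> (f ((shift ^^ i) y), \<phi> ((shift ^^ i) y)))"
        using Y(2)[OF yp] by (simp add: pos_less_divide_eq)
      then show ?thesis by (simp add: G_def sum_subtractf mult.commute)
    qed
    then obtain K where "\<And>x N. x \<in> \<Omega> \<Longrightarrow> - K \<le> (\<Sum>n<N. G ((shift ^^ n) x))"
      using Y_control[OF G] by metis
    then have "0 \<le> (\<integral>x. G x \<partial>M)"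
      by (rule integral_nonneg_of_birkhoff_bounded_below[OF integrable_block_fun[OF G]])
    then show False
      using ab(1) integral_inner_rot_vec[OF f \<phi>, of a b] by (simp add: G_def)
  qed
  \<comment> \<open>The candidate values of the objective over \<open>h\<close>; compactness of the
    slice provides the largest one, \<open>t\<close>.\<close>
  define S where "S = fst ` (H \<inter> UNIV \<times> {h})"
  have "compact S"
    unfolding S_def
    by (intro compact_continuous_image compact_Int_closed H continuous_on_fst continuous_on_id closed_Times) auto
  moreover have S_iff: "t \<in> S \<longleftrightarrow> (t, h) \<in> H" for t by (force simp: S_def)
  moreover obtain M0 where "M0 \<in> inv_measures \<Omega>" "rot_vec \<phi> M0 = h"
    using h by (auto simp: rot_set_def)
  then have "S \<noteq> {}" using in_H[of M0] S_iff by auto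
  ultimately obtain t where t: "(t, h) \<in> H" "\<And>s. (s, h) \<in> H \<Longrightarrow> s \<le> t"
    using compact_attains_sup[of S] by auto
  obtain u where u: "\<And>v. v \<in> c ` Y \<Longrightarrow> 0 \<le> u v" "sum u (c ` Y) = 1" "(\<Sum>v\<in>c ` Y. u v *\<^sub>R v) = (t, h)"
    using t(1) unfolding H_def convex_hull_finite[OF finite_imageI[OF Y(1)]] by blast
  obtain Q where Q: "set_pmf Q \<subseteq> c ` Y" "\<And>v. v \<in> c ` Y \<Longrightarrow> pmf Q v = u v"
    using pmf_with_weights[OF finite_imageI[OF Y(1)], of c u] u(1,2) by blast
  \<comment> \<open>Different cycles may have the same average, so one cycle is selected for each
    average.\<close>
  define r where "r = inv_into Y c"
  have r: "r v \<in> Y" "c (r v) = v" if "v \<in> c ` Y" for v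
    using that by (auto simp: r_def inv_into_into f_inv_into_f)
  have rY: "fst (r v) \<in> \<Omega>" "snd (r v) > 0" "(shift ^^ snd (r v)) (fst (r v)) = fst (r v)" if "v \<in> c ` Y" for v
    using Y(2)[of "fst (r v)" "snd (r v)"] r(1)[OF that] by auto
  \<comment> \<open>Draw an average with the law \<open>Q\<close>, then a uniform point of its
    selected cycle.\<close>
  define P where "P = bind_pmf Q (\<lambda>v. orbit_pmf (fst (r v)) (snd (r v)))"
  have P_set: "set_pmf P \<subseteq> \<Omega>"
    unfolding P_def using Q(1) rY shift_funpow_mem[OF \<Omega>(1)]
    by (fastforce simp: set_orbit_pmf)
  have P_inv: "map_pmf shift P = P"
    unfolding P_def map_bind_pmf
    by (intro bind_pmf_cong refl orbit_pmf_invariant rY(2,3) subsetD[OF Q(1)])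
  have P_exp: "measure_pmf.expectation P g =
      (\<Sum>v\<in>c ` Y. u v * ((\<Sum>i<snd (r v). g ((shift ^^ i) (fst (r v)))) / snd (r v)))" for g :: "_ \<Rightarrow> real"
    unfolding P_def using Q Y(1) rY
    by (subst pmf_expectation_bind[of "c ` Y"]) (auto simp: set_orbit_pmf expectation_orbit_pmf intro!: sum.cong)
  obtain \<nu> where \<nu>: "\<nu> \<in> inv_measures \<Omega>" "\<And>g :: _ \<Rightarrow> real. g \<in> borel_measurable (borel_shift \<Omega>) \<Longrightarrow>
       (\<integral>x. g x \<partial>\<nu>) = measure_pmf.expectation P g"
    using pmf_invariant_measure[OF \<Omega>(1) P_set P_inv] by blast
  have c_r: "v = cycle_average f \<phi> (fst (r v), snd (r v))" if "v \<in> c ` Y" for v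
    using r(2)[OF that] by (simp add: c_def)
  have c_fst: "(\<Sum>i<snd (r v). f ((shift ^^ i) (fst (r v)))) / snd (r v) = fst v" if "v \<in> c ` Y" for v
    \<comment> \<open>Only the occurrence of \<open>v\<close> on the right is unfolded; the other
      three select the cycle.\<close>
    by (subst (4) c_r[OF that]) (simp add: cycle_average_def split_beta fst_sum divide_inverse mult.commute)
  have c_snd: "(\<Sum>i<snd (r v). \<phi> ((shift ^^ i) (fst (r v))) $ l) / snd (r v) = snd v $ l" if "v \<in> c ` Y" for v l
    by (subst (4) c_r[OF that]) (simp add: cycle_average_def split_beta snd_sum divide_inverse mult.commute)
  have \<nu>_f: "(\<integral>x. f x \<partial>\<nu>) = t"
  proof -
    have "(\<integral>x. f x \<partial>\<nu>) = (\<Sum>v\<in>c ` Y. u v * fst v)"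
      unfolding \<nu>(2)[OF block_fun_measurable[OF f]] P_exp
      by (intro sum.cong refl arg_cong2[where f = "(*)"] c_fst)
    also have "\<dots> = fst (\<Sum>v\<in>c ` Y. u v *\<^sub>R v)" by (simp add: fst_sum)
    finally show ?thesis using u(3) by simp
  qed
  have "rot_vec \<phi> \<nu> $ l = h $ l" for l
  proof -
    have "rot_vec \<phi> \<nu> $ l = (\<integral>x. \<phi> x $ l \<partial>\<nu>)" by (simp add: rot_vec_def)
    also have "\<dots> = (\<Sum>v\<in>c ` Y. u v * snd v $ l)"
      unfolding \<nu>(2)[OF block_fun_measurable[OF \<phi>i]] P_exp
      by (intro sum.cong refl arg_cong2[where f = "(*)"] c_snd)
    also have "\<dots> = snd (\<Sum>v\<in>c ` Y. u v *\<^sub>R v) $ l" by (simp add: snd_sum)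
    finally show ?thesis using u(3) by simp
  qed
  then have \<nu>_rot: "rot_vec \<phi> \<nu> = h" by (simp add: vec_eq_iff)
  show ?thesis
  proof (rule that[OF \<nu>(1) \<nu>_rot])
    show "(\<integral>x. f x \<partial>M) \<le> (\<integral>x. f x \<partial>\<nu>)" if "M \<in> inv_measures \<Omega>" "rot_vec \<phi> M = h" for M
      using in_H[OF that(1)] that(2) t(2) \<nu>_f by simp
    have "finite (set_pmf (orbit_pmf (fst (r v)) (snd (r v))))" if "v \<in> set_pmf Q" for v
      by (simp only: set_orbit_pmf[OF rY(2)[OF subsetD[OF Q(1) that]]] finite_imageI finite_lessThan)
    then show "finite (set_pmf P)"
      using finite_subset[OF Q(1)] Y(1) by (simp add: P_def)
    show "set_pmf P \<noteq> {}" by (rule set_pmf_not_empty)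
    fix g :: "_ \<Rightarrow> real" assume "g \<in> borel_measurable (borel_shift \<Omega>)" "\<And>x. x \<in> set_pmf P \<Longrightarrow> g x = 0"
    then show "(\<integral>x. g x \<partial>\<nu>) = 0"
      by (subst \<nu>(2)) (auto intro!: integral_eq_zero_AE simp: AE_measure_pmf_iff)
  qed
qed

section \<open>Shannon entropy of labellings\<close>

lemma eta_nonneg: "0 \<le> p \<Longrightarrow> p \<le> 1 \<Longrightarrow> 0 \<le> eta p"
  by (auto simp: eta_def mult_nonneg_nonpos)

text \<open>The tangent to the concave function \<open>eta\<close> at \<open>1 / t\<close>, with its
  term \<open>- p\<close> dropped. Since \<open>t\<close> is free, it can be matched to the number
  of values in play.\<close>

lemma eta_le:
  assumes "0 \<le> p" "0 < t"
  shows "eta p \<le> p * ln t + 1 / t"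
proof (cases "p = 0")
  case False
  then have p: "p > 0" using assms by simp
  have "ln (1 / (p * t)) \<le> 1 / (p * t) - 1"
    using p assms by (intro ln_le_minus_one) simp
  then have "p * ln (1 / (p * t)) \<le> p * (1 / (p * t) - 1)"
    using p by simp
  also have "\<dots> \<le> 1 / t" using p assms by (simp add: field_simps)
  finally have "p * ln (1 / (p * t)) \<le> 1 / t" .
  moreover have "ln (1 / (p * t)) = - ln p - ln t"
    using p assms by (simp add: ln_div ln_mult)
  ultimately show ?thesis using p by (simp add: eta_def algebra_simps)
qed (use assms in \<open>simp add: eta_def\<close>)

text \<open>Serves for a value of mass near one, whose contribution is thus small.\<close>

lemma eta_le_one_minus:
  assumes "0 \<le> p" "p \<le> 1"
  shows "eta p \<le> 1 - p"
proof (cases "p = 0")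
  case False
  then have p: "p > 0" using assms by simp
  have "p * ln (1 / p) \<le> p * (1 / p - 1)"
    using p ln_le_minus_one[of "1 / p"] by (intro mult_left_mono) auto
  then show ?thesis using p by (simp add: eta_def ln_div algebra_simps)
qed (simp add: eta_def)

text \<open>Here \<open>1 \<le> t\<close> makes \<open>ln t\<close> nonnegative, so the total mass
  may be replaced by its bound \<open>s\<close>.\<close>

lemma sum_eta_le:
  assumes "\<And>v. v \<in> S \<Longrightarrow> 0 \<le> p v" "sum p S \<le> s" "1 \<le> t"
  shows "(\<Sum>v\<in>S. eta (p v)) \<le> s * ln t + card S / t"
proof -
  have "(\<Sum>v\<in>S. eta (p v)) \<le> (\<Sum>v\<in>S. p v * ln t + 1 / t)"
    using assms by (intro sum_mono eta_le) auto
  also have "\<dots> = sum p S * ln t + card S / t"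
    by (simp add: sum.distrib sum_distrib_right)
  also have "\<dots> \<le> s * ln t + card S / t"
    using assms by (intro add_right_mono mult_right_mono) auto
  finally show ?thesis .
qed

text \<open>Shannon entropy in nats. Labels have any type, so blocks, pairs, corrections and
  itineraries are treated alike, and \<open>partition_entropy\<close> is the case of
  itineraries.\<close>

definition label_entropy :: "'a measure \<Rightarrow> ('a \<Rightarrow> 'b) \<Rightarrow> real" where
  "label_entropy M X = (\<Sum>v\<in>X ` space M. eta (measure M {x \<in> space M. X x = v}))"

context prob_space
begin

text \<open>The bridge to the library notion with base \<open>exp 1\<close>, from which the chain
  rule and data processing are taken.\<close>

lemma label_entropy_eq_entropy:
  assumes X: "simple_function M X"
  shows "label_entropy M X = entropy (exp 1) (count_space (X ` space M)) X"
proof -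
  interpret information_space M "exp 1" by unfold_locales simp
  have "simple_distributed M X (\<lambda>v. measure M (X -` {v} \<inter> space M))"
    by (rule simple_distributedI[OF X]) auto
  then have "entropy (exp 1) (count_space (X ` space M)) X =
      - (\<Sum>v\<in>X ` space M. measure M (X -` {v} \<inter> space M) * log (exp 1) (measure M (X -` {v} \<inter> space M)))"
    by (rule entropy_simple_distributed)
  also have "\<dots> = (\<Sum>v\<in>X ` space M. eta (measure M {x \<in> space M. X x = v}))"
    unfolding sum_negf[symmetric]
    by (intro sum.cong) (auto simp: eta_def log_def vimage_def Int_def conj_commute)
  finally show ?thesis by (simp add: label_entropy_def)
qed

lemma label_entropy_cong:
  assumes "\<And>x. x \<in> space M \<Longrightarrow> X x = Y x"
  shows "label_entropy M X = label_entropy M Y"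
proof -
  have "X ` space M = Y ` space M" using assms by force
  moreover have "{x \<in> space M. X x = v} = {x \<in> space M. Y x = v}" for v using assms by auto
  ultimately show ?thesis by (simp add: label_entropy_def)
qed

text \<open>The chain rule, together with the fact that conditioning does not increase
  entropy.\<close>

lemma label_entropy_Pair_le:
  assumes "simple_function M X" "simple_function M Y"
  shows "label_entropy M (\<lambda>x. (X x, Y x)) \<le> label_entropy M X + label_entropy M Y"
proof -
  interpret information_space M "exp 1" by unfold_locales simp
  show ?thesis
    using entropy_chain_rule[OF assms] conditional_entropy_less_eq_entropy[OF assms(2,1)]
      assms simple_function_Pair[OF assms]
    by (simp add: label_entropy_eq_entropy)
qed

lemma label_entropy_fun_le:
  assumes X: "simple_function M X" and Z: "\<And>x. x \<in> space M \<Longrightarrow> Z x = f (X x)"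
  shows "label_entropy M Z \<le> label_entropy M X"
proof -
  interpret information_space M "exp 1" by unfold_locales simp
  have "label_entropy M Z = label_entropy M (f \<circ> X)" by (rule label_entropy_cong) (simp add: Z)
  also have "\<dots> \<le> label_entropy M X"
    using entropy_data_processing[OF X, of f] simple_function_compose[OF X, of f] X
    by (simp add: label_entropy_eq_entropy)
  finally show ?thesis .
qed

lemma label_entropy_join_le:
  assumes "simple_function M X" "simple_function M Y"
    and "\<And>x. x \<in> space M \<Longrightarrow> Z x = f (X x) (Y x)"
  shows "label_entropy M Z \<le> label_entropy M X + label_entropy M Y"
  using label_entropy_fun_le[OF simple_function_Pair[OF assms(1,2)], of Z "\<lambda>(a, b). f a b"]
    label_entropy_Pair_le[OF assms(1,2)] assms(3) by simp

lemma label_entropy_nonneg: "0 \<le> label_entropy M X"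
  unfolding label_entropy_def by (intro sum_nonneg eta_nonneg) auto

lemma simple_function_fibre: "simple_function M X \<Longrightarrow> {x \<in> space M. X x = v} \<in> sets M"
  using simple_functionD(2)[of M X "{v}"] by (simp add: vimage_def Int_def conj_commute)

lemma sum_prob_fibres:
  assumes "simple_function M X" "finite S"
  shows "(\<Sum>v\<in>S. measure M {x \<in> space M. X x = v}) = measure M {x \<in> space M. X x \<in> S}"
proof -
  have "measure M (\<Union>v\<in>S. {x \<in> space M. X x = v}) = (\<Sum>v\<in>S. measure M {x \<in> space M. X x = v})"
    using assms simple_function_fibre
    by (intro finite_measure_finite_Union) (auto simp: disjoint_family_on_def)
  moreover have "(\<Union>v\<in>S. {x \<in> space M. X x = v}) = {x \<in> space M. X x \<in> S}" by auto
  ultimately show ?thesis by simp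
qed

text \<open>\<open>sum_eta_le\<close> is applied with \<open>t = card S\<close> to the values in
  \<open>S\<close> and with \<open>t = N\<close> to the unlikely ones; each application leaves an
  error of at most 1.\<close>

lemma label_entropy_le_of_likely_values:
  assumes X: "simple_function M X" and S: "finite S" "S \<noteq> {}"
    and N: "card (X ` space M) \<le> N"
    and bad: "measure M {x \<in> space M. X x \<notin> S} \<le> s"
  shows "label_entropy M X \<le> ln (card S) + s * ln N + 2"
proof -
  define R where "R = X ` space M"
  have R: "finite R" using simple_functionD(1)[OF X] by (simp add: R_def)
  have "R \<noteq> {}" using not_empty by (simp add: R_def)
  then have N1: "1 \<le> real N" "real (card R) \<le> N"
    using N R card_gt_0_iff[of R] by (simp_all add: R_def)
  have S1: "1 \<le> real (card S)" using S card_gt_0_iff[of S] by simp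
  let ?p = "\<lambda>v. measure M {x \<in> space M. X x = v}"
  have "label_entropy M X = (\<Sum>v\<in>R \<inter> S. eta (?p v)) + (\<Sum>v\<in>R - S. eta (?p v))"
    unfolding label_entropy_def R_def[symmetric] by (rule sum.Int_Diff[OF R])
  also have "(\<Sum>v\<in>R \<inter> S. eta (?p v)) \<le> 1 * ln (card S) + card (R \<inter> S) / card S"
  proof (rule sum_eta_le)
    show "(\<Sum>v\<in>R \<inter> S. ?p v) \<le> 1" using R by (subst sum_prob_fibres[OF X]) auto
  qed (use S1 in auto)
  also have "real (card (R \<inter> S)) / card S \<le> 1"
    using S1 card_mono[OF S(1), of "R \<inter> S"] by (simp add: divide_le_eq_1)
  also have "(\<Sum>v\<in>R - S. eta (?p v)) \<le> s * ln N + card (R - S) / N"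
  proof (rule sum_eta_le)
    have "{x \<in> space M. X x \<in> R - S} = {x \<in> space M. X x \<notin> S}" by (auto simp: R_def)
    then show "(\<Sum>v\<in>R - S. ?p v) \<le> s" using R bad by (subst sum_prob_fibres[OF X]) auto
  qed (use N1 in auto)
  also have "real (card (R - S)) / N \<le> 1"
    using N1 card_mono[OF R, of "R - S"] by (simp add: divide_le_eq_1)
  finally show ?thesis by simp
qed

text \<open>\<open>None\<close> is the likely value and contributes at most \<open>s\<close>.
  Keeping \<open>t\<close> free allows the whole bound to be made arbitrarily small, without an
  additive constant.\<close>

lemma label_entropy_option_le:
  assumes X: "simple_function M X" and R: "X ` space M \<subseteq> insert None (Some ` R)" "finite R"
    and s: "measure M {x \<in> space M. X x \<noteq> None} \<le> s" and t: "1 \<le> t"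
  shows "label_entropy M X \<le> s + s * ln t + card R / t"
proof -
  let ?p = "\<lambda>v. measure M {x \<in> space M. X x = v}"
  have compl: "space M - {x \<in> space M. X x = None} = {x \<in> space M. X x \<noteq> None}" by auto
  have "label_entropy M X \<le> (\<Sum>v\<in>insert None (Some ` R). eta (?p v))"
    unfolding label_entropy_def using R by (intro sum_mono2) (auto intro: eta_nonneg)
  also have "\<dots> = eta (?p None) + (\<Sum>v\<in>Some ` R. eta (?p v))"
    using R by (subst sum.insert) auto
  also have "eta (?p None) \<le> 1 - ?p None" by (rule eta_le_one_minus) auto
  also have "1 - ?p None = measure M {x \<in> space M. X x \<noteq> None}"
    using prob_compl[OF simple_function_fibre[OF X, of None]] unfolding compl by simp
  also have "\<dots> \<le> s" by (rule s)
  also have "(\<Sum>v\<in>Some ` R. eta (?p v)) \<le> s * ln t + card (Some ` R) / t"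
  proof (rule sum_eta_le)
    have "{x \<in> space M. X x \<in> Some ` R} = {x \<in> space M. X x \<noteq> None}" using R by auto
    then show "(\<Sum>v\<in>Some ` R. ?p v) \<le> s" using R s by (subst sum_prob_fibres[OF X]) auto
  qed (use t in auto)
  finally show ?thesis by (simp add: card_image)
qed

end

section \<open>Kolmogorov--Sinai entropy from block entropies\<close>

lemma take_block: "k \<le> n \<Longrightarrow> take k (block n x) = block k x"
  by (simp add: block_def take_map)

lemma block_add: "block (a + b) x = block a x @ block b ((shift ^^ a) x)"
  by (auto simp: list_eq_iff_nth_eq nth_append shift_funpow)

lemma (in finite_measure) incseq_measure_diff_small:
  assumes "range A \<subseteq> sets M" "incseq A" "(0::real) < e"
  shows "\<exists>n. measure M ((\<Union>i. A i) - A n) < e"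
proof -
  have "(\<lambda>n. measure M (A n)) \<longlonglongrightarrow> measure M (\<Union>i. A i)"
    by (rule finite_Lim_measure_incseq[OF assms(1,2)])
  then obtain n where "\<bar>measure M (A n) - measure M (\<Union>i. A i)\<bar> < e"
    using assms(3) unfolding LIMSEQ_iff by (metis order_refl real_norm_def)
  moreover have "measure M ((\<Union>i. A i) - A n) = measure M (\<Union>i. A i) - measure M (A n)"
    using assms(1) by (intro finite_measure_Diff) auto
  ultimately show ?thesis by (intro exI[of _ n]) linarith
qed

context invariant_measure
begin

lemma block_set_M: "{x \<in> \<Omega>. block k x \<in> W} \<in> sets M"
  using block_set_measurable sets_M by simp

lemma simple_block: "simple_function M (block k)"
  unfolding simple_function_def
proof (intro conjI ballI)
  fix w
  have "block k -` {w} \<inter> space M = {x \<in> \<Omega>. block k x \<in> {w}}" by auto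
  then show "block k -` {w} \<inter> space M \<in> sets M" using block_set_M[of k "{w}"] by simp
qed (rule finite_image_block)

lemma simple_shift_funpow:
  assumes "simple_function M X"
  shows "simple_function M (\<lambda>x. X ((shift ^^ n) x))"
  unfolding simple_function_def
proof (intro conjI ballI)
  have "(\<lambda>x. X ((shift ^^ n) x)) ` space M \<subseteq> X ` space M"
    using shift_funpow_mem[OF \<Omega>] by auto
  then show "finite ((\<lambda>x. X ((shift ^^ n) x)) ` space M)"
    using simple_functionD(1)[OF assms] by (rule finite_subset)
  fix v
  have "(shift ^^ n) -` (X -` {v} \<inter> space M) \<inter> space M \<in> sets M"
    by (rule measurable_sets[OF shift_funpow_measurable simple_functionD(2)[OF assms]])
  moreover have "(shift ^^ n) -` (X -` {v} \<inter> space M) \<inter> space M = (\<lambda>x. X ((shift ^^ n) x)) -` {v} \<inter> space M"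
    using shift_funpow_mem[OF \<Omega>] by auto
  ultimately show "(\<lambda>x. X ((shift ^^ n) x)) -` {v} \<inter> space M \<in> sets M" by simp
qed

text \<open>Invariance makes the masses agree; the shift need not map onto \<open>\<Omega>\<close>,
  so the left sum may run over fewer values.\<close>

lemma label_entropy_shift_funpow_le:
  assumes X: "simple_function M X"
  shows "label_entropy M (\<lambda>x. X ((shift ^^ n) x)) \<le> label_entropy M X"
proof -
  have "measure M {x \<in> space M. X ((shift ^^ n) x) = v} = measure M {x \<in> space M. X x = v}" for v
  proof -
    have "{x \<in> space M. X ((shift ^^ n) x) = v} = {x \<in> \<Omega>. (shift ^^ n) x \<in> {x \<in> space M. X x = v}}"
      using shift_funpow_mem[OF \<Omega>] by auto
    then show ?thesis using measure_shift_funpow[OF simple_function_fibre[OF X]] by simp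
  qed
  then have "label_entropy M (\<lambda>x. X ((shift ^^ n) x)) =
      (\<Sum>v\<in>(\<lambda>x. X ((shift ^^ n) x)) ` space M. eta (measure M {x \<in> space M. X x = v}))"
    by (simp add: label_entropy_def)
  also have "\<dots> \<le> label_entropy M X"
    unfolding label_entropy_def using shift_funpow_mem[OF \<Omega>] simple_functionD(1)[OF X]
    by (intro sum_mono2) (auto intro: eta_nonneg)
  finally show ?thesis .
qed

lemma label_entropy_itinerary_le:
  assumes X: "simple_function M X"
  shows "simple_function M (\<lambda>x. map (\<lambda>i. X ((shift ^^ i) x)) [0..<n])"
    and "label_entropy M (\<lambda>x. map (\<lambda>i. X ((shift ^^ i) x)) [0..<n]) \<le> n * label_entropy M X"
proof (induction n)
  case 0
  case 1 show ?case by simp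
  case 2
  have "measure M \<Omega> = 1" using prob_space by simp
  then show ?case by (simp add: label_entropy_def eta_def image_constant_conv)
next
  case (Suc n)
  let ?I = "\<lambda>n x. map (\<lambda>i. X ((shift ^^ i) x)) [0..<n]"
  note sh = simple_shift_funpow[OF X, of n]
  have eq: "?I (Suc n) = (\<lambda>(l, a). l @ [a]) \<circ> (\<lambda>x. (?I n x, X ((shift ^^ n) x)))"
    by (simp add: fun_eq_iff)
  case 1 show ?case
    unfolding eq by (intro simple_function_compose simple_function_Pair Suc.IH sh)
  case 2
  have "label_entropy M (?I (Suc n)) \<le> label_entropy M (?I n) + label_entropy M (\<lambda>x. X ((shift ^^ n) x))"
    by (rule label_entropy_join_le[OF Suc.IH(1) sh, where f = "\<lambda>l a. l @ [a]"]) simp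
  then show ?case
    using Suc.IH(2) label_entropy_shift_funpow_le[OF X, of n] by (simp add: algebra_simps)
qed

lemma block_entropy_mono: "m \<le> n \<Longrightarrow> label_entropy M (block m) \<le> label_entropy M (block n)"
  by (rule label_entropy_fun_le[OF simple_block, where f = "take m"]) (simp add: take_block)

lemma block_entropy_mult: "label_entropy M (block (q * L)) \<le> q * label_entropy M (block L)"
proof (induction q)
  case 0
  have "measure M \<Omega> = 1" using prob_space by simp
  then show ?case
    by (simp add: label_entropy_def eta_def block_def image_constant_conv)
next
  case (Suc q)
  have "label_entropy M (block (q * L + L)) \<le>
      label_entropy M (block (q * L)) + label_entropy M (\<lambda>x. block L ((shift ^^ (q * L)) x))"
    by (rule label_entropy_join_le[OF simple_block simple_shift_funpow[OF simple_block], where f = append])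
      (simp add: block_add)
  then show ?case
    using Suc.IH label_entropy_shift_funpow_le[OF simple_block, of L "q * L"]
    by (simp add: algebra_simps)
qed

text \<open>Subadditivity after rounding \<open>n\<close> up to a multiple of \<open>L\<close>,
  which costs the extra \<open>1\<close>.\<close>

lemma block_entropy_linear_bound:
  assumes "L > 0"
  shows "label_entropy M (block n) \<le> (real n / L + 1) * label_entropy M (block L)"
proof -
  have "n \<le> (n div L + 1) * L"
    using div_mult_mod_eq[of n L] mod_less_divisor[OF assms, of n] unfolding add_mult_distrib by linarith
  then have "label_entropy M (block n) \<le> label_entropy M (block ((n div L + 1) * L))"
    by (rule block_entropy_mono)
  also have "\<dots> \<le> real (n div L + 1) * label_entropy M (block L)" by (rule block_entropy_mult)
  also have "\<dots> \<le> (real n / L + 1) * label_entropy M (block L)"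
    using of_nat_div_le_of_nat[of n L, where ?'a = real] by (intro mult_right_mono label_entropy_nonneg) simp
  finally show ?thesis .
qed

section \<open>Approximation by finite blocks\<close>

text \<open>The approximable sets contain the open sets, which are increasing unions of block sets,
  and are closed under complements and countable unions.\<close>

lemma approx_by_block_set:
  assumes "A \<in> sets M" "e > 0"
  shows "\<exists>k W. measure M {x \<in> \<Omega>. (x \<in> A) \<noteq> (block k x \<in> W)} < e"
proof -
  have "A \<in> sigma_sets \<Omega> {U. openin (subtopology shift_top \<Omega>) U}"
    using assms(1) by (simp add: sets_M sets_borel_shift)
  then show ?thesis using assms(2)
  proof (induction arbitrary: e rule: sigma_sets.induct)
    case (Basic U)
    then have U: "U \<subseteq> \<Omega>" "\<And>x. x \<in> U \<Longrightarrow> \<exists>k. \<forall>y\<in>\<Omega>. block k y = block k x \<longrightarrow> y \<in> U"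
      by (auto simp: openin_subshift_iff)
    \<comment> \<open>The words whose cylinder lies inside \<open>U\<close>; words that do not occur
      in \<open>\<Omega>\<close> belong vacuously.\<close>
    define W where "W k = {w. \<forall>y\<in>\<Omega>. block k y = w \<longrightarrow> y \<in> U}" for k
    define B where "B k = {x \<in> \<Omega>. block k x \<in> W k}" for k
    have "incseq B"
      unfolding incseq_def
    proof (intro allI impI subsetI)
      fix m n x assume mn: "m \<le> n" and "x \<in> B m"
      then have x: "x \<in> \<Omega>" "\<And>y. y \<in> \<Omega> \<Longrightarrow> block m y = block m x \<Longrightarrow> y \<in> U"
        by (auto simp: B_def W_def)
      have "y \<in> U" if "y \<in> \<Omega>" "block n y = block n x" for y
        by (rule x(2)[OF that(1) block_eq_mono[OF that(2) mn]])
      then show "x \<in> B n" using x(1) by (simp add: B_def W_def)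
    qed
    moreover have "range B \<subseteq> sets M" unfolding B_def using block_set_M by blast
    ultimately obtain n where n: "measure M ((\<Union>i. B i) - B n) < e"
      using incseq_measure_diff_small Basic.prems by blast
    have "(\<Union>i. B i) = U"
    proof (intro equalityI subsetI)
      fix x assume x: "x \<in> U"
      then obtain i where "\<forall>y\<in>\<Omega>. block i y = block i x \<longrightarrow> y \<in> U" using U(2) by blast
      then have "x \<in> B i" using x U(1) by (auto simp: B_def W_def)
      then show "x \<in> (\<Union>i. B i)" by blast
    qed (auto simp: B_def W_def)
    then have "B n \<subseteq> U" by blast
    moreover have "{x \<in> \<Omega>. (x \<in> U) \<noteq> (block n x \<in> W n)} = {x \<in> \<Omega>. (x \<in> U) \<noteq> (x \<in> B n)}"
      unfolding B_def by blast
    ultimately have "{x \<in> \<Omega>. (x \<in> U) \<noteq> (block n x \<in> W n)} = (\<Union>i. B i) - B n"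
      using U(1) \<open>(\<Union>i. B i) = U\<close> by blast
    then have "measure M {x \<in> \<Omega>. (x \<in> U) \<noteq> (block n x \<in> W n)} < e" using n by simp
    then show ?case by blast
  next
    case Empty
    then show ?case by (intro exI[of _ 0] exI[of _ "{}"]) simp
  next
    case (Compl A)
    then obtain k W where "measure M {x \<in> \<Omega>. (x \<in> A) \<noteq> (block k x \<in> W)} < e" by blast
    moreover have "{x \<in> \<Omega>. (x \<in> \<Omega> - A) \<noteq> (block k x \<in> - W)} = {x \<in> \<Omega>. (x \<in> A) \<noteq> (block k x \<in> W)}"
      by auto
    ultimately have "measure M {x \<in> \<Omega>. (x \<in> \<Omega> - A) \<noteq> (block k x \<in> - W)} < e" by simp
    then show ?case by blast
  next
    case (Union A)
    have A: "A i \<in> sets M" for i using Union.hyps by (simp add: sets_M sets_borel_shift)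
    define B where "B n = (\<Union>i<n. A i)" for n
    have "incseq B" unfolding incseq_def B_def by fastforce
    moreover have "range B \<subseteq> sets M" unfolding B_def using A by auto
    ultimately obtain n where n: "measure M ((\<Union>i. B i) - B n) < e / 2"
      using incseq_measure_diff_small[of B "e / 2"] Union.prems by auto
    have UB: "(\<Union>i. B i) = (\<Union>i. A i)" unfolding B_def by blast
    \<comment> \<open>Truncating the union costs \<open>e / 2\<close>, and \<open>n\<close> errors
      below \<open>d\<close> cost at most the other half; \<open>n + 1\<close> avoids a zero
      denominator.\<close>
    define d where "d = e / (2 * (real n + 1))"
    have "d > 0" using Union.prems by (simp add: d_def)
    then have "\<forall>i. \<exists>k W. measure M {x \<in> \<Omega>. (x \<in> A i) \<noteq> (block k x \<in> W)} < d"
      by (intro allI Union.IH)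
    then obtain k W where kW: "\<And>i. measure M {x \<in> \<Omega>. (x \<in> A i) \<noteq> (block (k i) x \<in> W i)} < d"
      unfolding choice_iff by blast
    define D where "D i = {x \<in> \<Omega>. (x \<in> A i) \<noteq> (block (k i) x \<in> W i)}" for i
    have D: "D i \<in> sets M" for i
    proof -
      have "D i = (A i - {x \<in> \<Omega>. block (k i) x \<in> W i}) \<union> ({x \<in> \<Omega>. block (k i) x \<in> W i} - A i)"
        using sets.sets_into_space[OF A[of i]] by (auto simp: D_def)
      then show ?thesis using A block_set_M by simp
    qed
    \<comment> \<open>A common length for all tests; including \<open>n\<close> keeps the set
      nonempty when \<open>n = 0\<close>.\<close>
    define K where "K = Max (k ` {..n})"
    have K: "k i \<le> K" if "i < n" for i unfolding K_def using that by (intro Max_ge) auto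
    define V where "V = {w. \<exists>i<n. take (k i) w \<in> W i}"
    have V: "block K x \<in> V \<longleftrightarrow> (\<exists>i<n. block (k i) x \<in> W i)" for x
      using K by (auto simp: V_def take_block)
    have sub: "{x \<in> \<Omega>. (x \<in> (\<Union>i. A i)) \<noteq> (block K x \<in> V)} \<subseteq> ((\<Union>i. A i) - B n) \<union> (\<Union>i<n. D i)"
      unfolding V B_def D_def by auto
    have m1: "(\<Union>i. A i) - B n \<in> sets M" and m2: "(\<Union>i<n. D i) \<in> sets M"
      unfolding B_def using A D by auto
    have "measure M {x \<in> \<Omega>. (x \<in> (\<Union>i. A i)) \<noteq> (block K x \<in> V)}
        \<le> measure M (((\<Union>i. A i) - B n) \<union> (\<Union>i<n. D i))"
      using m1 m2 by (intro finite_measure_mono[OF sub]) simp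
    also have "\<dots> \<le> measure M ((\<Union>i. A i) - B n) + measure M (\<Union>i<n. D i)"
      by (rule measure_Un_le[OF m1 m2])
    also have "measure M (\<Union>i<n. D i) \<le> (\<Sum>i<n. measure M (D i))"
      using D by (intro finite_measure_subadditive_finite) auto
    also have "\<dots> \<le> (\<Sum>i<n. d)"
      using kW by (intro sum_mono) (auto simp: D_def less_imp_le)
    also have "\<dots> \<le> e / 2"
      using Union.prems by (simp add: d_def field_simps)
    finally have "measure M {x \<in> \<Omega>. (x \<in> (\<Union>i. A i)) \<noteq> (block K x \<in> V)} < e"
      using n by (simp add: UB)
    then show ?case by blast
  qed
qed

text \<open>Every fibre of \<open>X\<close> is approximated by a block set, and
  \<open>\<eta>\<close> picks a value whose test succeeds. Outside the union of the error sets
  exactly one test succeeds, the one for \<open>X x\<close>.\<close>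

lemma approx_by_block_labelling:
  assumes X: "simple_function M X" and "e > 0"
  shows "\<exists>k \<eta>. measure M {x \<in> \<Omega>. X x \<noteq> \<eta> (block k x)} < e"
proof -
  define R where "R = X ` \<Omega>"
  have R: "finite R" using simple_functionD(1)[OF X] by (simp add: R_def)
  have "R \<noteq> {}" using not_empty by (simp add: R_def)
  then have cR: "card R > 0" using R by (simp add: card_gt_0_iff)
  define A where "A v = {x \<in> \<Omega>. X x = v}" for v
  have A: "A v \<in> sets M" for v using simple_function_fibre[OF X] by (simp add: A_def)
  have "e / card R > 0" using \<open>e > 0\<close> cR by simp
  then have "\<forall>v. \<exists>k W. measure M {x \<in> \<Omega>. (x \<in> A v) \<noteq> (block k x \<in> W)} < e / card R"
    by (intro allI approx_by_block_set[OF A])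
  then obtain k W where kW: "\<And>v. measure M {x \<in> \<Omega>. (x \<in> A v) \<noteq> (block (k v) x \<in> W v)} < e / card R"
    unfolding choice_iff by blast
  define D where "D v = {x \<in> \<Omega>. (x \<in> A v) \<noteq> (block (k v) x \<in> W v)}" for v
  have D: "D v \<in> sets M" for v
  proof -
    have "D v = (A v - {x \<in> \<Omega>. block (k v) x \<in> W v}) \<union> ({x \<in> \<Omega>. block (k v) x \<in> W v} - A v)"
      by (auto simp: D_def A_def)
    then show ?thesis using A block_set_M by simp
  qed
  define K where "K = Max (k ` R)"
  have K: "k v \<le> K" if "v \<in> R" for v unfolding K_def using that R by (intro Max_ge) auto
  define \<eta> where "\<eta> w = (SOME v. v \<in> R \<and> take (k v) w \<in> W v)" for w
  have "{x \<in> \<Omega>. X x \<noteq> \<eta> (block K x)} \<subseteq> (\<Union>v\<in>R. D v)"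
  proof (rule subsetI, rule ccontr)
    fix x assume x: "x \<in> {x \<in> \<Omega>. X x \<noteq> \<eta> (block K x)}" and "x \<notin> (\<Union>v\<in>R. D v)"
    then have iff: "X x = v \<longleftrightarrow> block (k v) x \<in> W v" if "v \<in> R" for v
      using that by (auto simp: D_def A_def)
    have "v \<in> R \<and> take (k v) (block K x) \<in> W v \<longleftrightarrow> v = X x" for v
    proof (cases "v \<in> R")
      case True
      then show ?thesis using take_block[OF K[OF True], of x] iff[OF True] by auto
    next
      case False
      then show ?thesis using x by (auto simp: R_def)
    qed
    then have "\<eta> (block K x) = X x" by (simp add: \<eta>_def)
    then show False using x by simp
  qed
  then have "measure M {x \<in> \<Omega>. X x \<noteq> \<eta> (block K x)} \<le> measure M (\<Union>v\<in>R. D v)"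
    using D R by (intro finite_measure_mono) auto
  also have "\<dots> \<le> (\<Sum>v\<in>R. measure M (D v))"
    using D R by (intro finite_measure_subadditive_finite) auto
  also have "\<dots> < (\<Sum>v\<in>R. e / card R)"
    using kW R \<open>R \<noteq> {}\<close> by (intro sum_strict_mono) (auto simp: D_def)
  also have "\<dots> = e" using cR by simp
  finally show ?thesis by blast
qed

text \<open>The itinerary of \<open>X\<close> is recovered from a block of length
  \<open>n + k\<close>, which predicts it, and from the itinerary of corrections \<open>E\<close>,
  whose entropy is at most \<open>e\<close> per step.\<close>

lemma itinerary_entropy_le:
  assumes X: "simple_function M X" and "(e::real) > 0"
  obtains k where "\<And>n. label_entropy M (\<lambda>x. map (\<lambda>i. X ((shift ^^ i) x)) [0..<n])
      \<le> label_entropy M (block (n + k)) + n * e"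
proof -
  define R where "R = X ` \<Omega>"
  have R: "finite R" using simple_functionD(1)[OF X] by (simp add: R_def)
  \<comment> \<open>First \<open>t\<close> makes \<open>card R / t\<close> at most
    \<open>e / 2\<close>; then \<open>d\<close> is fitted so that \<open>d + d * ln t\<close> is the
    other half.\<close>
  define t where "t = max 1 (2 * card R / e)"
  have t: "1 \<le> t" "card R / t \<le> e / 2"
    using \<open>e > 0\<close> by (auto simp: t_def field_simps max_def)
  define d where "d = e / 2 / (1 + ln t)"
  have lnt: "ln t \<ge> 0" using t by simp
  have d: "d > 0" using \<open>e > 0\<close> lnt by (simp add: d_def)
  have "d * (1 + ln t) = e / 2" using lnt unfolding d_def by (intro nonzero_eq_divide_eq[THEN iffD1]) auto
  then have dt: "d + d * ln t = e / 2" by (simp add: distrib_left)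
  obtain k \<eta> where k: "measure M {x \<in> \<Omega>. X x \<noteq> \<eta> (block k x)} < d"
    using approx_by_block_labelling[OF X d] by blast
  \<comment> \<open>\<open>E\<close> reveals the true label exactly where the prediction
    fails.\<close>
  define E where "E x = (if X x = \<eta> (block k x) then None else Some (X x))" for x
  have "E = (\<lambda>(v, w). if v = \<eta> w then None else Some v) \<circ> (\<lambda>x. (X x, block k x))"
    by (simp add: fun_eq_iff E_def)
  then have E: "simple_function M E"
    using simple_function_compose[OF simple_function_Pair[OF X simple_block[of k]]] by simp
  have "{x \<in> space M. E x \<noteq> None} = {x \<in> \<Omega>. X x \<noteq> \<eta> (block k x)}" by (auto simp: E_def)
  then have "label_entropy M E \<le> d + d * ln t + card R / t"
    using k t R by (intro label_entropy_option_le[OF E]) (auto simp: E_def R_def)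
  then have hE: "label_entropy M E \<le> e" using t(2) dt by linarith
  show ?thesis
  proof
    fix n
    let ?I = "\<lambda>Z x. map (\<lambda>i. Z ((shift ^^ i) x)) [0..<n]"
    \<comment> \<open>The decoder: at time \<open>i\<close> it predicts from the window starting at
      \<open>i\<close>, unless a correction is supplied.\<close>
    define F where "F w l = map (\<lambda>i. case l ! i of None \<Rightarrow> \<eta> (take k (drop i w)) | Some v \<Rightarrow> v) [0..<n]"
      for w :: "'a list" and l
    have "?I X x = F (block (n + k) x) (?I E x)" for x
    proof -
      have "take k (drop i (block (n + k) x)) = block k ((shift ^^ i) x)" if "i < n" for i
        using that by (auto simp: list_eq_iff_nth_eq shift_funpow)
      then show ?thesis by (auto simp: F_def E_def)
    qed
    then have "label_entropy M (?I X) \<le> label_entropy M (block (n + k)) + label_entropy M (?I E)"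
      by (intro label_entropy_join_le[OF simple_block label_entropy_itinerary_le(1)[OF E], where f = F])
    also have "label_entropy M (?I E) \<le> n * label_entropy M E" by (rule label_entropy_itinerary_le(2)[OF E])
    also have "\<dots> \<le> n * e" using hE by (intro mult_left_mono) auto
    finally show "label_entropy M (?I X) \<le> label_entropy M (block (n + k)) + n * e" by simp
  qed
qed

text \<open>Blocks generate, so small block entropy rates bound the rate of every partition. Since
  \<open>lim\<close> has a meaningful value only for convergent sequences, convergence to 0 is
  proved rather than a mere upper bound.\<close>

lemma ks_entropy_eq_0:
  assumes L: "\<And>m::nat. \<exists>L>0. label_entropy M (block L) \<le> L / (m + 1)"
  shows "ks_entropy \<Omega> M = 0"
proof -
  have "lim (\<lambda>n. partition_entropy \<Omega> M \<xi> n / n) = 0" if "\<xi> \<in> finite_partitions \<Omega>" for \<xi>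
  proof -
    have "\<xi> \<in> measurable M (count_space UNIV)" "finite (\<xi> ` space M)"
      using that by (simp_all add: finite_partitions_def measurable_M_iff)
    then have \<xi>: "simple_function M \<xi>"
      by (simp add: simple_function_eq_measurable)
    define H where "H n = partition_entropy \<Omega> M \<xi> n" for n
    have H: "H n = label_entropy M (\<lambda>x. map (\<lambda>i. \<xi> ((shift ^^ i) x)) [0..<n])" for n
      by (simp add: H_def partition_entropy_def label_entropy_def itinerary_def[abs_def])
    have "(\<lambda>n. H n / n) \<longlonglongrightarrow> 0"
    proof (rule LIMSEQ_I)
      fix e :: real assume e: "e > 0"
      obtain k where k: "\<And>n. H n \<le> label_entropy M (block (n + k)) + n * (e / 3)"
        unfolding H using itinerary_entropy_le[OF \<xi>, of "e / 3"] e by auto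
      obtain m :: nat where "1 / (m + 1) < e / 3"
        using reals_Archimedean[of "e / 3"] e by (auto simp: field_simps)
      then obtain L where L: "L > 0" "label_entropy M (block L) \<le> L * (e / 3)"
        using assms[of m] by (metis (no_types, opaque_lifting) divide_inverse less_eq_real_def
            mult.commute mult_left_mono of_nat_0_le_iff order_trans mult_1)
      \<comment> \<open>The part that does not grow with \<open>n\<close>. The growing part takes
        \<open>2 * e / 3\<close> per step, and \<open>C < n * (e / 3)\<close> once \<open>n\<close>
        exceeds \<open>3 * C / e\<close>.\<close>
      define C where "C = k * (e / 3) + label_entropy M (block L)"
      have "C \<ge> 0" using e label_entropy_nonneg[of "block L"] by (simp add: C_def)
      obtain N :: nat where N: "3 * C / e < N" using reals_Archimedean2 by blast
      have "norm (H n / n - 0) < e" if n: "n \<ge> N" for n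
      proof -
        have "3 * C / e \<ge> 0" using \<open>C \<ge> 0\<close> e by simp
        then have n0: "real n > 0" "3 * C / e < n" using N n by linarith+
        have "H n \<le> (real (n + k) / L + 1) * label_entropy M (block L) + n * (e / 3)"
          using k[of n] block_entropy_linear_bound[OF L(1), of "n + k"] by linarith
        also have "\<dots> = real (n + k) * (label_entropy M (block L) / L) + label_entropy M (block L) + n * (e / 3)"
          by (simp add: algebra_simps)
        also have "\<dots> \<le> real (n + k) * (e / 3) + label_entropy M (block L) + n * (e / 3)"
          using L by (intro add_right_mono mult_left_mono) (simp_all add: divide_le_eq mult.commute)
        also have "\<dots> = n * (2 * e / 3) + C" by (simp add: C_def field_simps)
        also have "\<dots> < n * e"
          using n0 e by (simp add: field_simps)
        finally have "H n / n < e" using n0 by (simp add: divide_less_eq mult.commute)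
        moreover have "H n / n \<ge> 0" by (simp add: H label_entropy_nonneg)
        ultimately show ?thesis by simp
      qed
      then show "\<exists>N. \<forall>n\<ge>N. norm (H n / n - 0) < e" by blast
    qed
    then show ?thesis unfolding H_def by (rule limI)
  qed
  \<comment> \<open>Some partition must exist, since an empty supremum in \<open>ereal\<close> would
    be minus infinity.\<close>
  moreover have "(\<lambda>_. 0) \<in> finite_partitions \<Omega>"
    by (simp add: finite_partitions_def) (metis finite.simps finite_subset image_constant_conv)
  then have "finite_partitions \<Omega> \<noteq> {}" by blast
  ultimately show ?thesis by (simp add: ks_entropy_def zero_ereal_def)
qed

end

section \<open>Generic functions\<close>

text \<open>With \<open>\<Omega>\<close> empty, \<open>sup_dist\<close> would be the supremum of an
  empty set of reals.\<close>

locale nonempty_subshift =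
  fixes \<Omega> :: "(nat \<Rightarrow> 'a::finite) set"
  assumes \<Omega>: "subshift \<Omega>" and nonempty: "\<Omega> \<noteq> {}"
begin

section \<open>The complete metric space of continuous functions\<close>

lemma sup_dist_upper:
  assumes "f \<in> cont_fun \<Omega>" "g \<in> cont_fun \<Omega>" "x \<in> \<Omega>"
  shows "\<bar>f x - g x\<bar> \<le> sup_dist \<Omega> f g"
proof -
  have "continuous_map (subtopology shift_top \<Omega>) euclideanreal (\<lambda>x. f x - g x)"
    using assms(1,2) by (intro continuous_map_diff) (auto simp: cont_fun_def)
  then obtain B where "\<And>x. x \<in> \<Omega> \<Longrightarrow> \<bar>f x - g x\<bar> \<le> B"
    using continuous_map_bounded[OF \<Omega>] by blast
  then have "bdd_above ((\<lambda>x. \<bar>f x - g x\<bar>) ` \<Omega>)" by (auto simp: bdd_above_def)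
  then show ?thesis unfolding sup_dist_def by (rule cSUP_upper[OF assms(3)])
qed

lemma sup_dist_least: "(\<And>x. x \<in> \<Omega> \<Longrightarrow> \<bar>f x - g x\<bar> \<le> c) \<Longrightarrow> sup_dist \<Omega> f g \<le> c"
  unfolding sup_dist_def using nonempty by (intro cSUP_least) auto

lemma sup_dist_nonneg: "f \<in> cont_fun \<Omega> \<Longrightarrow> g \<in> cont_fun \<Omega> \<Longrightarrow> 0 \<le> sup_dist \<Omega> f g"
  using sup_dist_upper nonempty by (metis abs_ge_zero equals0I order_trans)

lemma sup_dist_commute: "sup_dist \<Omega> f g = sup_dist \<Omega> g f"
  by (simp add: sup_dist_def abs_minus_commute)

lemma sup_dist_triangle:
  assumes "f \<in> cont_fun \<Omega>" "g \<in> cont_fun \<Omega>" "h \<in> cont_fun \<Omega>"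
  shows "sup_dist \<Omega> f h \<le> sup_dist \<Omega> f g + sup_dist \<Omega> g h"
proof (rule sup_dist_least)
  fix x assume "x \<in> \<Omega>"
  then show "\<bar>f x - h x\<bar> \<le> sup_dist \<Omega> f g + sup_dist \<Omega> g h"
    using sup_dist_upper[OF assms(1,2), of x] sup_dist_upper[OF assms(2,3), of x] by linarith
qed

text \<open>Outside \<open>cont_fun\<close> the supremum in \<open>sup_dist\<close> may be a junk value, so the metric is
  cut off there.\<close>

definition C_dist :: "((nat \<Rightarrow> 'a) \<Rightarrow> real) \<Rightarrow> ((nat \<Rightarrow> 'a) \<Rightarrow> real) \<Rightarrow> real" where
  "C_dist f g = (if f \<in> cont_fun \<Omega> \<and> g \<in> cont_fun \<Omega> then sup_dist \<Omega> f g else 0)"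

sublocale C: Metric_space "cont_fun \<Omega>" C_dist
proof
  fix f g h
  show "0 \<le> C_dist f g" by (simp add: C_dist_def sup_dist_nonneg)
  show "C_dist f g = C_dist g f" by (auto simp: C_dist_def sup_dist_commute)
  show "C_dist f g = 0 \<longleftrightarrow> f = g" if fg: "f \<in> cont_fun \<Omega>" "g \<in> cont_fun \<Omega>"
  proof
    assume "C_dist f g = 0"
    then have "f x = g x" if "x \<in> \<Omega>" for x
      using sup_dist_upper[OF fg that] fg by (simp add: C_dist_def)
    moreover have "f x = g x" if "x \<notin> \<Omega>" for x using fg that by (simp add: cont_fun_def)
    ultimately show "f = g" by blast
  next
    assume "f = g"
    then have "sup_dist \<Omega> f g \<le> 0" by (intro sup_dist_least) simp
    then show "C_dist f g = 0" using fg sup_dist_nonneg[OF fg] by (simp add: C_dist_def)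
  qed
  show "C_dist f h \<le> C_dist f g + C_dist g h"
    if "f \<in> cont_fun \<Omega>" "g \<in> cont_fun \<Omega>" "h \<in> cont_fun \<Omega>"
    using that sup_dist_triangle by (simp add: C_dist_def)
qed

text \<open>A Cauchy sequence converges pointwise, the convergence is uniform, and a uniform limit
  of continuous functions is continuous. The limit is set to 0 off \<open>\<Omega>\<close>, as
  \<open>cont_fun\<close> demands.\<close>

lemma mcomplete_C: "C.mcomplete"
  unfolding C.mcomplete_def
proof (intro allI impI)
  fix F assume "C.MCauchy F"
  then have F: "\<And>n. F n \<in> cont_fun \<Omega>"
    and Cauchy: "\<And>e. e > 0 \<Longrightarrow> \<exists>N. \<forall>n n'. N \<le> n \<longrightarrow> N \<le> n' \<longrightarrow> C_dist (F n) (F n') < e"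
    unfolding C.MCauchy_def by auto
  have unif: "\<exists>N. \<forall>n\<ge>N. \<forall>n'\<ge>N. \<forall>x\<in>\<Omega>. \<bar>F n x - F n' x\<bar> < e" if e: "e > 0" for e
  proof -
    obtain N where N: "\<And>n n'. N \<le> n \<Longrightarrow> N \<le> n' \<Longrightarrow> sup_dist \<Omega> (F n) (F n') < e"
      using Cauchy[OF e] F by (auto simp: C_dist_def)
    have "\<bar>F n x - F n' x\<bar> < e" if "N \<le> n" "N \<le> n'" "x \<in> \<Omega>" for n n' x
      using sup_dist_upper[OF F F that(3), of n n'] N[OF that(1,2)] by linarith
    then show ?thesis by blast
  qed
  define g where "g x = (if x \<in> \<Omega> then lim (\<lambda>n. F n x) else 0)" for x
  have lim: "(\<lambda>n. F n x) \<longlonglongrightarrow> g x" if "x \<in> \<Omega>" for x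
  proof -
    have "Cauchy (\<lambda>n. F n x)"
      unfolding Cauchy_def dist_real_def using unif that by meson
    then have "convergent (\<lambda>n. F n x)" by (rule real_Cauchy_convergent)
    then show ?thesis using that by (simp add: g_def convergent_LIMSEQ_iff)
  qed
  have close: "\<exists>N. \<forall>n\<ge>N. \<forall>x\<in>\<Omega>. \<bar>F n x - g x\<bar> \<le> e" if "e > 0" for e
  proof -
    obtain N where N: "\<And>n n' x. N \<le> n \<Longrightarrow> N \<le> n' \<Longrightarrow> x \<in> \<Omega> \<Longrightarrow> \<bar>F n x - F n' x\<bar> < e"
      using unif[OF \<open>e > 0\<close>] by blast
    have "\<bar>F n x - g x\<bar> \<le> e" if "N \<le> n" "x \<in> \<Omega>" for n x
    proof (rule LIMSEQ_le_const2)
      show "(\<lambda>n'. \<bar>F n x - F n' x\<bar>) \<longlonglongrightarrow> \<bar>F n x - g x\<bar>"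
        by (intro tendsto_intros lim that)
      show "\<exists>N'. \<forall>n'\<ge>N'. \<bar>F n x - F n' x\<bar> \<le> e"
        using N[OF that(1) _ that(2)] by (intro exI[of _ N]) (auto intro: less_imp_le)
    qed
    then show ?thesis by blast
  qed
  have "continuous_map (subtopology shift_top \<Omega>) Met_TC.mtopology g"
  proof (rule Met_TC.continuous_map_uniform_limit[where F = sequentially and f = F])
    show "\<forall>\<^sub>F n in sequentially. continuous_map (subtopology shift_top \<Omega>) Met_TC.mtopology (F n)"
      using F by (auto simp: cont_fun_def)
    fix e :: real assume "e > 0"
    then obtain N where N: "\<forall>n\<ge>N. \<forall>x\<in>\<Omega>. \<bar>F n x - g x\<bar> \<le> e / 2" using close[of "e / 2"] by auto
    show "\<forall>\<^sub>F n in sequentially. \<forall>x\<in>topspace (subtopology shift_top \<Omega>). g x \<in> UNIV \<and> dist (F n x) (g x) < e"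
      unfolding eventually_sequentially
    proof (intro exI[of _ N] allI impI ballI conjI)
      fix n x assume "N \<le> n" "x \<in> topspace (subtopology shift_top \<Omega>)"
      then have "\<bar>F n x - g x\<bar> \<le> e / 2" using N by simp
      then show "dist (F n x) (g x) < e" using \<open>e > 0\<close> by (simp add: dist_real_def)
    qed simp
  qed simp
  then have g: "g \<in> cont_fun \<Omega>" by (simp add: cont_fun_def g_def)
  have "limitin C.mtopology F g sequentially"
    unfolding C.limitin_metric eventually_sequentially
  proof (intro conjI allI impI g)
    fix e :: real assume "e > 0"
    then obtain N where N: "\<forall>n\<ge>N. \<forall>x\<in>\<Omega>. \<bar>F n x - g x\<bar> \<le> e / 2" using close[of "e / 2"] by auto
    have "C_dist (F n) g < e" if "n \<ge> N" for n
    proof -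
      have "sup_dist \<Omega> (F n) g \<le> e / 2" using N that by (intro sup_dist_least) simp
      then show ?thesis using F g \<open>e > 0\<close> by (simp add: C_dist_def)
    qed
    then show "\<exists>N. \<forall>n\<ge>N. F n \<in> cont_fun \<Omega> \<and> C_dist (F n) g < e" using F by blast
  qed
  then show "\<exists>g. limitin C.mtopology F g sequentially" by blast
qed

text \<open>Openness and density in the sense of \<open>sup_dist\<close> are translated into the
  topology of \<open>C_dist\<close>, where the Baire category theorem applies.\<close>

lemma Baire_cont_fun:
  assumes U: "\<And>n::nat. open_in_C \<Omega> (U n)" "\<And>n. dense_in_C \<Omega> (U n)"
  shows "dense_in_C \<Omega> (\<Inter>n. U n)"
proof -
  have sub: "U n \<subseteq> cont_fun \<Omega>" for n using U(1) by (simp add: open_in_C_def)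
  have closure: "C.mtopology closure_of S = cont_fun \<Omega> \<longleftrightarrow> dense_in_C \<Omega> S" if "S \<subseteq> cont_fun \<Omega>" for S
  proof -
    have "C.mtopology closure_of S = {f \<in> cont_fun \<Omega>. \<forall>r>0. \<exists>g\<in>S. sup_dist \<Omega> f g < r}"
      unfolding C.metric_closure_of using that by (auto simp: C_dist_def C.in_mball; blast)
    then show ?thesis using that unfolding dense_in_C_def by blast
  qed
  have "openin C.mtopology (U n)" for n
    unfolding C.openin_mtopology
  proof (intro conjI sub allI impI)
    fix f assume f: "f \<in> U n"
    then obtain e where "e > 0" "\<And>g. g \<in> cont_fun \<Omega> \<Longrightarrow> sup_dist \<Omega> f g < e \<Longrightarrow> g \<in> U n"
      using U(1)[of n] unfolding open_in_C_def by blast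
    then show "\<exists>r>0. C.mball f r \<subseteq> U n"
      by (intro exI[of _ e]) (auto simp: C.in_mball C_dist_def)
  qed
  then have "C.mtopology closure_of \<Inter>(range U) = cont_fun \<Omega>"
    using closure[OF sub] U(2) by (intro C.metric_Baire_category mcomplete_C) auto
  then show ?thesis using closure[of "\<Inter>(range U)"] sub by blast
qed

section \<open>Perturbation to small block entropy\<close>

text \<open>\<open>f\<close> is evaluated at one fixed representative of each block of a length on
  which it is uniformly almost constant.\<close>

lemma cont_fun_approx_block_fun:
  assumes f: "f \<in> cont_fun \<Omega>" and "e > 0"
  obtains k f1 where "block_fun \<Omega> k f1" "\<And>x. x \<in> \<Omega> \<Longrightarrow> \<bar>f x - f1 x\<bar> < e"
proof -
  obtain k where k: "\<And>x y. x \<in> \<Omega> \<Longrightarrow> y \<in> \<Omega> \<Longrightarrow> block k x = block k y \<Longrightarrow> \<bar>f x - f y\<bar> < e"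
    using continuous_imp_block_uniform[OF \<Omega> _ \<open>e > 0\<close>, of f] f by (auto simp: cont_fun_def)
  define f1 where "f1 x = f (inv_into \<Omega> (block k) (block k x))" for x
  have "block_fun \<Omega> k f1" unfolding block_fun_def f1_def by simp
  moreover have "\<bar>f x - f1 x\<bar> < e" if "x \<in> \<Omega>" for x
    unfolding f1_def using that by (intro k) (simp_all add: inv_into_into f_inv_into_f)
  ultimately show ?thesis by (rule that)
qed

text \<open>The order of choices matters: \<open>f1\<close> fixes \<open>Z\<close>, then
  \<open>Z\<close> and \<open>m\<close> fix \<open>L\<close>, and only then come the penalty and the
  radius \<open>r\<close>. The penalty has height \<open>e / 3\<close> for every \<open>L\<close>,
  so \<open>g\<close> stays close to \<open>f\<close>.\<close>

lemma dense_low_block_entropy: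
  fixes \<phi> :: "(nat \<Rightarrow> 'a) \<Rightarrow> real ^ 'd" and m :: nat
  assumes sofic: "sofic \<Omega>" and lc: "locally_constant \<Omega> \<phi>" and h: "h \<in> rot_set \<Omega> \<phi>"
    and f: "f \<in> cont_fun \<Omega>" and e: "e > 0"
  shows "\<exists>g\<in>cont_fun \<Omega>. sup_dist \<Omega> f g < e \<and> (\<exists>r>0. \<forall>f'\<in>cont_fun \<Omega>. sup_dist \<Omega> g f' < r \<longrightarrow>
     (\<forall>M\<in>rel_max_measures \<Omega> \<phi> h f'. \<exists>L>0. label_entropy M (block L) \<le> L / (m + 1)))"
proof -
  have e3: "e / 3 > 0" using e by simp
  obtain k f1 where f1: "block_fun \<Omega> k f1" "\<And>x. x \<in> \<Omega> \<Longrightarrow> \<bar>f x - f1 x\<bar> < e / 3"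
    using cont_fun_approx_block_fun[OF f e3] by blast
  obtain \<nu> Z where \<nu>: "\<nu> \<in> inv_measures \<Omega>" "rot_vec \<phi> \<nu> = h"
    and max: "\<And>M. M \<in> inv_measures \<Omega> \<Longrightarrow> rot_vec \<phi> M = h \<Longrightarrow> (\<integral>x. f1 x \<partial>M) \<le> (\<integral>x. f1 x \<partial>\<nu>)"
    and Z: "finite Z" "Z \<noteq> {}"
    and \<nu>_Z: "\<And>g :: _ \<Rightarrow> real. g \<in> borel_measurable (borel_shift \<Omega>) \<Longrightarrow> (\<And>x. x \<in> Z \<Longrightarrow> g x = 0) \<Longrightarrow>
       (\<integral>x. g x \<partial>\<nu>) = 0"
    using relative_maximizer_finite_support[OF \<Omega> sofic lc h f1(1)] by blast
  define q where "q = card Z"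
  \<comment> \<open>In \<open>ln q + 3\<close> the 3 is the constant 2 of
    \<open>label_entropy_le_of_likely_values\<close> plus the bound 1 on \<open>d * ln N\<close>;
    the final \<open>+ 1\<close> keeps \<open>L\<close> positive.\<close>
  define L where "L = nat \<lceil>(m + 1) * (ln q + 3)\<rceil> + 1"
  have L: "L > 0" "ln q + 3 \<le> L / (m + 1)"
  proof -
    have "(m + 1) * (ln q + 3) \<le> L" unfolding L_def by linarith
    then show "ln q + 3 \<le> L / (m + 1)" by (simp add: field_simps)
  qed (simp add: L_def)
  define S where "S = block L ` Z"
  have S: "finite S" "S \<noteq> {}" using Z by (simp_all add: S_def)
  have "ln (card S) \<le> ln q"
    using card_image_le[OF Z(1), of "block L"] S card_gt_0_iff[of S] by (simp add: q_def S_def)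
  define N where "N = card (block L ` \<Omega>)"
  have "N > 0" using nonempty finite_image_block by (auto simp: N_def card_gt_0_iff)
  then have lnN: "ln N \<ge> 0" by simp
  \<comment> \<open>The mass permitted off \<open>S\<close>: small enough to offset the logarithm of
    the number of all blocks of length \<open>L\<close>.\<close>
  define d where "d = 1 / (1 + ln N)"
  have d: "d > 0" "d * ln N \<le> 1" using lnN by (simp_all add: d_def divide_le_eq)
  define bad where "bad x = (if block L x \<in> S then 0 else 1 :: real)" for x
  have bad: "block_fun \<Omega> L bad" by (simp add: block_fun_def bad_def)
  \<comment> \<open>\<open>f1\<close> need not vanish off \<open>\<Omega>\<close>, so
    \<open>g\<close> is cut off there to belong to \<open>cont_fun\<close>.\<close>
  define g where "g x = (if x \<in> \<Omega> then f1 x - e / 3 * bad x else 0)" for x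
  have "block_fun \<Omega> (max k L) f1" "block_fun \<Omega> (max k L) bad"
    using block_fun_mono[OF f1(1)] block_fun_mono[OF bad] by simp_all
  then have g_block: "block_fun \<Omega> (max k L) g"
    unfolding block_fun_def g_def by (metis (no_types, lifting))
  then have g: "g \<in> cont_fun \<Omega>"
    using block_fun_continuous_map by (auto simp: cont_fun_def g_def)
  have "sup_dist \<Omega> f g \<le> 2 * e / 3"
  proof (rule sup_dist_least)
    fix x assume x: "x \<in> \<Omega>"
    have "g x = f1 x \<or> g x = f1 x - e / 3" using x by (simp add: g_def bad_def)
    then show "\<bar>f x - g x\<bar> \<le> 2 * e / 3" using f1(2)[OF x] by linarith
  qed
  then have fg: "sup_dist \<Omega> f g < e" using e by simp
  \<comment> \<open>Half of \<open>e / 3 * d\<close>, because the comparison of \<open>g\<close>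
    with \<open>f'\<close> is made twice, for \<open>M\<close> and for \<open>\<nu>\<close>.\<close>
  define r where "r = e / 3 * d / 2"
  have r: "r > 0" using e d by (simp add: r_def)
  have "\<exists>L>0. label_entropy M (block L) \<le> L / (m + 1)"
    if f': "f' \<in> cont_fun \<Omega>" "sup_dist \<Omega> g f' < r" and M_max: "M \<in> rel_max_measures \<Omega> \<phi> h f'" for f' M
  proof -
    have M: "M \<in> inv_measures \<Omega>" "rot_vec \<phi> M = h" "(\<integral>x. f' x \<partial>M) = rel_max_value \<Omega> \<phi> h f'"
      using M_max by (simp_all add: rel_max_measures_def)
    interpret M: invariant_measure \<Omega> M using \<Omega> M by unfold_locales
    interpret \<nu>: invariant_measure \<Omega> \<nu> using \<Omega> \<nu> by unfold_locales
    have cf': "continuous_map (subtopology shift_top \<Omega>) euclideanreal f'" using f' by (simp add: cont_fun_def)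
    have near: "\<bar>(\<integral>x. g x \<partial>K) - (\<integral>x. f' x \<partial>K)\<bar> \<le> sup_dist \<Omega> g f'" if K: "K \<in> inv_measures \<Omega>" for K
    proof -
      interpret K: invariant_measure \<Omega> K using \<Omega> K by unfold_locales
      have int: "integrable K g" "integrable K f'"
        using K.integrable_block_fun[OF g_block] K.integrable_continuous[OF cf'] by auto
      then have "\<bar>(\<integral>x. g x \<partial>K) - (\<integral>x. f' x \<partial>K)\<bar> = \<bar>\<integral>x. g x - f' x \<partial>K\<bar>" by simp
      also have "\<dots> \<le> (\<integral>x. \<bar>g x - f' x\<bar> \<partial>K)" by (rule integral_abs_bound)
      also have "\<dots> \<le> (\<integral>x. sup_dist \<Omega> g f' \<partial>K)"
        using int sup_dist_upper[OF g f'(1)] by (intro integral_mono) auto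
      also have "\<dots> = sup_dist \<Omega> g f'" using K.prob_space by simp
      finally show ?thesis .
    qed
    \<comment> \<open>\<open>\<nu>\<close> satisfies the constraint and thus competes with
      \<open>M\<close>; the real supremum also requires boundedness.\<close>
    have \<nu>_le: "(\<integral>x. f' x \<partial>\<nu>) \<le> (\<integral>x. f' x \<partial>M)"
      unfolding M(3) rel_max_value_def
    proof (rule cSup_upper)
      show "(\<integral>x. f' x \<partial>\<nu>) \<in> {\<integral>x. f' x \<partial>M |M. M \<in> inv_measures \<Omega> \<and> rot_vec \<phi> M = h}"
        using \<nu> by blast
      obtain B where B: "\<And>x. x \<in> \<Omega> \<Longrightarrow> \<bar>f' x\<bar> \<le> B" using continuous_map_bounded[OF \<Omega> cf'] by blast
      have "(\<integral>x. f' x \<partial>K) \<le> B" if K: "K \<in> inv_measures \<Omega>" for K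
      proof -
        interpret K: invariant_measure \<Omega> K using \<Omega> K by unfold_locales
        have "(\<integral>x. f' x \<partial>K) \<le> (\<integral>x. B \<partial>K)"
          using B K.integrable_continuous[OF cf'] by (intro integral_mono) (auto simp: abs_le_iff)
        then show ?thesis using K.prob_space by simp
      qed
      then show "bdd_above {\<integral>x. f' x \<partial>M |M. M \<in> inv_measures \<Omega> \<and> rot_vec \<phi> M = h}"
        by (intro bdd_aboveI[of _ B]) blast
    qed
    have g_int: "(\<integral>x. g x \<partial>K) = (\<integral>x. f1 x \<partial>K) - e / 3 * (\<integral>x. bad x \<partial>K)"
      if K: "K \<in> inv_measures \<Omega>" for K
    proof -
      interpret K: invariant_measure \<Omega> K using \<Omega> K by unfold_locales
      have "(\<integral>x. g x \<partial>K) = (\<integral>x. f1 x - e / 3 * bad x \<partial>K)"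
        by (intro Bochner_Integration.integral_cong) (simp_all add: g_def)
      then show ?thesis
        using K.integrable_block_fun[OF f1(1)] K.integrable_block_fun[OF bad] by simp
    qed
    have \<nu>_bad: "(\<integral>x. bad x \<partial>\<nu>) = 0"
      by (rule \<nu>_Z[OF block_fun_measurable[OF bad]]) (simp add: bad_def S_def)
    \<comment> \<open>Passing from \<open>g\<close> to \<open>f'\<close> and back loses twice the
      distance, so \<open>M\<close> is almost as good for \<open>g\<close> as \<open>\<nu>\<close>.
      Since \<open>\<nu>\<close> pays no penalty and is optimal for \<open>f1\<close>, the penalty
      paid by \<open>M\<close> is at most that loss.\<close>
    have "e / 3 * (\<integral>x. bad x \<partial>M) \<le> 2 * sup_dist \<Omega> g f'"
      using near[OF M(1)] near[OF \<nu>(1)] \<nu>_le max[OF M(1,2)] g_int[OF M(1)] g_int[OF \<nu>(1), unfolded \<nu>_bad]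
      unfolding abs_le_iff mult_zero_right by linarith
    also have "\<dots> \<le> e / 3 * d" using f'(2) by (simp add: r_def)
    finally have "(\<integral>x. bad x \<partial>M) \<le> d" using e3 by (simp only: mult_le_cancel_left_pos)
    moreover have "(\<integral>x. bad x \<partial>M) = measure M {x \<in> space M. block L x \<notin> S}"
    proof -
      have "(\<integral>x. bad x \<partial>M) = (\<integral>x. indicator {x \<in> space M. block L x \<notin> S} x \<partial>M)"
        by (intro Bochner_Integration.integral_cong) (simp_all add: bad_def)
      moreover have "{x \<in> space M. block L x \<notin> S} \<inter> space M = {x \<in> space M. block L x \<notin> S}" by blast
      ultimately show ?thesis by simp
    qed
    ultimately have "measure M {x \<in> space M. block L x \<notin> S} \<le> d" by simp
    then have "label_entropy M (block L) \<le> ln (card S) + d * ln N + 2"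
      by (intro M.label_entropy_le_of_likely_values[OF M.simple_block S]) (simp_all add: N_def)
    then show ?thesis using L d(2) \<open>ln (card S) \<le> ln q\<close> by (intro exI[of _ L]) linarith
  qed
  then show ?thesis using g fg r by blast
qed

end

theorem theoremB:
  fixes \<Omega> :: "(nat \<Rightarrow> 'a::finite) set"
    and \<phi> :: "(nat \<Rightarrow> 'a) \<Rightarrow> real ^ 'd"
    and h :: "real ^ 'd"
  assumes "subshift \<Omega>" and "irreducible_shift \<Omega>" and "sofic \<Omega>"
    and "\<forall>x \<in> \<Omega>. \<forall>i. \<phi> x $ i \<in> \<rat>"
    and "locally_constant \<Omega> \<phi>"
    and "h \<in> interior (rot_set \<Omega> \<phi>)"
    and "\<forall>i. h $ i \<in> \<rat>"
  shows "\<exists>R. dense_Gdelta_in_C \<Omega> R \<and>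
           (\<forall>f \<in> R. \<forall>M \<in> rel_max_measures \<Omega> \<phi> h f. ks_entropy \<Omega> M = 0)"
proof -
  have h: "h \<in> rot_set \<Omega> \<phi>" using assms(6) interior_subset by blast
  \<comment> \<open>A probability measure lives on \<open>\<Omega>\<close>, which is therefore
    nonempty.\<close>
  then obtain M0 where M0: "M0 \<in> inv_measures \<Omega>" by (auto simp: rot_set_def)
  interpret M0: invariant_measure \<Omega> M0 using assms(1) M0 by unfold_locales
  interpret nonempty_subshift \<Omega>
    using assms(1) M0.not_empty by unfold_locales simp_all
  define low where "low m f \<longleftrightarrow>
      (\<forall>M\<in>rel_max_measures \<Omega> \<phi> h f. \<exists>L>0. label_entropy M (block L) \<le> L / (m + 1))" for m :: nat and f
  \<comment> \<open>The interior of the set of functions satisfying \<open>low m\<close>, hence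
    open.\<close>
  define U where "U m = {f \<in> cont_fun \<Omega>. \<exists>r>0. \<forall>g\<in>cont_fun \<Omega>. sup_dist \<Omega> f g < r \<longrightarrow> low m g}" for m
  have U_open: "open_in_C \<Omega> (U m)" for m
    unfolding open_in_C_def
  proof (intro conjI ballI)
    fix f assume "f \<in> U m"
    then obtain r where f: "f \<in> cont_fun \<Omega>" and r: "r > 0"
      and low: "\<And>g. g \<in> cont_fun \<Omega> \<Longrightarrow> sup_dist \<Omega> f g < r \<Longrightarrow> low m g" by (auto simp: U_def)
    have "g \<in> U m" if g: "g \<in> cont_fun \<Omega>" "sup_dist \<Omega> f g < r / 2" for g
    proof -
      have "low m g'" if "g' \<in> cont_fun \<Omega>" "sup_dist \<Omega> g g' < r / 2" for g'
        using sup_dist_triangle[OF f g(1) that(1)] g(2) that by (intro low) auto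
      then show ?thesis using g r by (auto simp: U_def intro!: exI[of _ "r / 2"])
    qed
    then show "\<exists>e>0. \<forall>g\<in>cont_fun \<Omega>. sup_dist \<Omega> f g < e \<longrightarrow> g \<in> U m"
      using r by (intro exI[of _ "r / 2"]) auto
  qed (auto simp: U_def)
  have U_dense: "dense_in_C \<Omega> (U m)" for m
    unfolding dense_in_C_def
  proof (intro conjI ballI allI impI)
    fix f and e :: real assume "f \<in> cont_fun \<Omega>" "e > 0"
    then show "\<exists>g\<in>U m. sup_dist \<Omega> f g < e"
      using dense_low_block_entropy[OF assms(3,5) h, of f e m] unfolding U_def low_def by blast
  qed (auto simp: U_def)
  have "ks_entropy \<Omega> M = 0" if f: "f \<in> (\<Inter>m. U m)" and M_max: "M \<in> rel_max_measures \<Omega> \<phi> h f" for f M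
  proof -
    interpret invariant_measure \<Omega> M
      using assms(1) M_max by unfold_locales (simp_all add: rel_max_measures_def)
    show ?thesis
    proof (rule ks_entropy_eq_0)
      fix m :: nat
      obtain r where "f \<in> cont_fun \<Omega>" "r > 0" "\<And>g. g \<in> cont_fun \<Omega> \<Longrightarrow> sup_dist \<Omega> f g < r \<Longrightarrow> low m g"
        using INT_D[OF f, of m] unfolding U_def by blast
      \<comment> \<open>\<open>f\<close> lies in its own ball, so \<open>low m\<close> holds for
        \<open>f\<close> itself.\<close>
      moreover have "sup_dist \<Omega> f f \<le> 0" by (rule sup_dist_least) simp
      ultimately have "low m f" by simp
      then show "\<exists>L>0. label_entropy M (block L) \<le> L / (m + 1)" using M_max by (simp add: low_def)
    qed
  qed
  moreover have "dense_Gdelta_in_C \<Omega> (\<Inter>m. U m)"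
    unfolding dense_Gdelta_in_C_def using Baire_cont_fun[of U] U_open U_dense by blast
  ultimately show ?thesis by blast
qed

end
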